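(* Let $(\mathcal C,\mathcal D)$ be a quantum Manin pair such that $T\colon\mathcal C\to\mathcal D$ satisfies the projection formula and $T^R\colon\mathcal D\to\mathcal C$ is monadic. Let $A\in\mathcal D$ be an algebra, $\mathcal F=TT^R(1)$, let $\mu\colon\mathcal F\to A$ be an algebra map in $\mathcal D$ and let $\mu'\colon T^R(1)\to T^R(A)$ be the adjoint algebra map in $\mathcal C$. Then $\mu$ is a quantum moment map if and only if $\mu'$ is central, i.e. $m\circ(\mu'\otimes\mathrm{id})=m\circ(\mathrm{id}\otimes\mu')\circ\sigma_{T^R(1),T^R(A)}$ as maps $T^R(1)\otimes T^R(A)\to T^R(A)$, where $m$ is the multiplication of $T^R(A)$.
   Context: All monoidal categories are $k$-linear ($k$ a commutative ring), locally presentable, with tensor product preserving colimits in each variable. A quantum Manin pair $(\mathcal C,\mathcal D)$ is a braided monoidal category $\mathcal C$ (braiding $\sigma$) and a monoidal category $\mathcal D$ with a colimit-preserving braided monoidal functor from $\mathcal C$ to the Drinfeld center of $\mathcal D$; explicitly, a monoidal functor $T\colon\mathcal C\to\mathcal D$ and isomorphisms $\tau_{X,V}\colon T(X)\otimes V\to V\otimes T(X)$ natural in $X\in\mathcal C,V\in\mathcal D$, compatible with tensor products in $X$ and $V$, with $\tau_{X,T(Y)}=T(\sigma_{X,Y})$. The right adjoint $T^R$ is lax monoidal; hence it sends algebras to algebras, and algebra maps $TT^R(1)\to A$ in $\mathcal D$ correspond by adjunction to algebra maps $T^R(1)\to T^R(A)$ in $\mathcal C$. $T$ satisfies the projection formula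 if the natural morphism $X\otimes T^R(V)\to T^R(T(X)\otimes V)$ is an isomorphism for all $X\in\mathcal C$, $V\in\mathcal D$. $T^R$ is monadic if the functor $\mathcal D\to\mathrm{LMod}_{T^R(1)}(\mathcal C)$, $V\mapsto T^R(V)$, is an equivalence. A quantum moment map is an algebra map $\mu\colon\mathcal F\to A$ in $\mathcal D$ such that $m_A\circ(\mu\otimes\mathrm{id})=m_A\circ(\mathrm{id}\otimes\mu)\circ\tau_{T^R(1),A}$ as maps $\mathcal F\otimes A\to A$. *)

theory Defs
  imports "HOL-Algebra.Module"
begin

unbundle cardinal_syntax

section \<open>Categories, functors, natural transformations\<close>

record ('o, 'm) cat =
  Obj :: "'o set"
  Arr :: "'m set"
  source :: "'m \<Rightarrow> 'o"
  target :: "'m \<Rightarrow> 'o"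
  ident :: "'o \<Rightarrow> 'm"
  cmp :: "'m \<Rightarrow> 'm \<Rightarrow> 'm"  (infixl \<open>\<cdot>\<index>\<close> 65)

definition Hom :: "('o, 'm, 'z) cat_scheme \<Rightarrow> 'o \<Rightarrow> 'o \<Rightarrow> 'm set" where
  "Hom C x y = {f \<in> Arr C. source C f = x \<and> target C f = y}"

locale category =
  fixes C :: "('o, 'm, 'z) cat_scheme" (structure)
  assumes source_closed: "f \<in> Arr C \<Longrightarrow> source C f \<in> Obj C"
    and target_closed: "f \<in> Arr C \<Longrightarrow> target C f \<in> Obj C"
    and ident_closed: "x \<in> Obj C \<Longrightarrow> ident C x \<in> Hom C x x"
    and cmp_closed: "\<lbrakk>f \<in> Hom C x y; g \<in> Hom C y z\<rbrakk> \<Longrightarrow> g \<cdot> f \<in> Hom C x z"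
    and ident_left: "f \<in> Hom C x y \<Longrightarrow> ident C y \<cdot> f = f"
    and ident_right: "f \<in> Hom C x y \<Longrightarrow> f \<cdot> ident C x = f"
    and cmp_assoc: "\<lbrakk>f \<in> Hom C w x; g \<in> Hom C x y; h \<in> Hom C y z\<rbrakk>
      \<Longrightarrow> (h \<cdot> g) \<cdot> f = h \<cdot> (g \<cdot> f)"

definition inverse_pair :: "('o, 'm, 'z) cat_scheme \<Rightarrow> 'm \<Rightarrow> 'm \<Rightarrow> bool" where
  "inverse_pair C f g \<longleftrightarrow>
     f \<in> Hom C (source C f) (target C f) \<and> g \<in> Hom C (target C f) (source C f) \<and>
     g \<cdot>\<^bsub>C\<^esub> f = ident C (source C f) \<and> f \<cdot>\<^bsub>C\<^esub> g = ident C (target C f)"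

definition is_iso :: "('o, 'm, 'z) cat_scheme \<Rightarrow> 'm \<Rightarrow> bool" where
  "is_iso C f \<longleftrightarrow> (\<exists>g. inverse_pair C f g)"

definition inverse_arr :: "('o, 'm, 'z) cat_scheme \<Rightarrow> 'm \<Rightarrow> 'm" where
  "inverse_arr C f = (THE g. inverse_pair C f g)"

record ('o1, 'm1, 'o2, 'm2) func =
  ob :: "'o1 \<Rightarrow> 'o2"
  ar :: "'m1 \<Rightarrow> 'm2"

definition is_functor ::
  "('o1, 'm1, 'z1) cat_scheme \<Rightarrow> ('o2, 'm2, 'z2) cat_scheme \<Rightarrow>
   ('o1, 'm1, 'o2, 'm2, 'y) func_scheme \<Rightarrow> bool" where
  "is_functor C D F \<longleftrightarrow> category C \<and> category D \<and>
     (\<forall>x \<in> Obj C. ob F x \<in> Obj D) \<and>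
     (\<forall>x \<in> Obj C. \<forall>y \<in> Obj C. \<forall>f \<in> Hom C x y. ar F f \<in> Hom D (ob F x) (ob F y)) \<and>
     (\<forall>x \<in> Obj C. ar F (ident C x) = ident D (ob F x)) \<and>
     (\<forall>x \<in> Obj C. \<forall>y \<in> Obj C. \<forall>z \<in> Obj C. \<forall>f \<in> Hom C x y. \<forall>g \<in> Hom C y z.
        ar F (g \<cdot>\<^bsub>C\<^esub> f) = ar F g \<cdot>\<^bsub>D\<^esub> ar F f)"

definition id_func :: "('o, 'm, 'o, 'm) func" where
  "id_func = \<lparr>ob = (\<lambda>x. x), ar = (\<lambda>f. f)\<rparr>"

definition comp_func ::
  "('o2, 'm2, 'o3, 'm3, 'y) func_scheme \<Rightarrow> ('o1, 'm1, 'o2, 'm2, 'w) func_scheme \<Rightarrow>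
   ('o1, 'm1, 'o3, 'm3) func" where
  "comp_func G F = \<lparr>ob = (\<lambda>x. ob G (ob F x)), ar = (\<lambda>f. ar G (ar F f))\<rparr>"

definition natural_transformation ::
  "('o1, 'm1, 'z1) cat_scheme \<Rightarrow> ('o2, 'm2, 'z2) cat_scheme \<Rightarrow>
   ('o1, 'm1, 'o2, 'm2, 'y) func_scheme \<Rightarrow> ('o1, 'm1, 'o2, 'm2, 'w) func_scheme \<Rightarrow>
   ('o1 \<Rightarrow> 'm2) \<Rightarrow> bool" where
  "natural_transformation C D F G \<alpha> \<longleftrightarrow> is_functor C D F \<and> is_functor C D G \<and>
     (\<forall>x \<in> Obj C. \<alpha> x \<in> Hom D (ob F x) (ob G x)) \<and>
     (\<forall>x \<in> Obj C. \<forall>y \<in> Obj C. \<forall>f \<in> Hom C x y.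
        \<alpha> y \<cdot>\<^bsub>D\<^esub> ar F f = ar G f \<cdot>\<^bsub>D\<^esub> \<alpha> x)"

definition natural_isomorphism ::
  "('o1, 'm1, 'z1) cat_scheme \<Rightarrow> ('o2, 'm2, 'z2) cat_scheme \<Rightarrow>
   ('o1, 'm1, 'o2, 'm2, 'y) func_scheme \<Rightarrow> ('o1, 'm1, 'o2, 'm2, 'w) func_scheme \<Rightarrow>
   ('o1 \<Rightarrow> 'm2) \<Rightarrow> bool" where
  "natural_isomorphism C D F G \<alpha> \<longleftrightarrow>
     natural_transformation C D F G \<alpha> \<and> (\<forall>x \<in> Obj C. is_iso D (\<alpha> x))"

definition is_equivalence ::
  "('o1, 'm1, 'z1) cat_scheme \<Rightarrow> ('o2, 'm2, 'z2) cat_scheme \<Rightarrow>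
   ('o1, 'm1, 'o2, 'm2, 'y) func_scheme \<Rightarrow> bool" where
  "is_equivalence C D F \<longleftrightarrow> is_functor C D F \<and>
     (\<exists>(G :: ('o2, 'm2, 'o1, 'm1) func) \<alpha> \<beta>. is_functor D C G \<and>
        natural_isomorphism C C id_func (comp_func G F) \<alpha> \<and>
        natural_isomorphism D D (comp_func F G) id_func \<beta>)"

text \<open>A right adjoint is a functor together with a unit and a counit.\<close>

record ('oc, 'mc, 'od, 'md) radj = "('od, 'md, 'oc, 'mc) func" +
  adj_unit :: "'oc \<Rightarrow> 'mc"
  adj_counit :: "'od \<Rightarrow> 'md"

definition is_right_adjoint ::
  "('oc, 'mc, 'z1) cat_scheme \<Rightarrow> ('od, 'md, 'z2) cat_scheme \<Rightarrow>
   ('oc, 'mc, 'od, 'md, 'y) func_scheme \<Rightarrow> ('oc, 'mc, 'od, 'md) radj \<Rightarrow> bool" where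
  "is_right_adjoint C D T R \<longleftrightarrow> is_functor C D T \<and> is_functor D C R \<and>
     natural_transformation C C id_func (comp_func R T) (adj_unit R) \<and>
     natural_transformation D D (comp_func T R) id_func (adj_counit R) \<and>
     (\<forall>x \<in> Obj C. adj_counit R (ob T x) \<cdot>\<^bsub>D\<^esub> ar T (adj_unit R x) = ident D (ob T x)) \<and>
     (\<forall>v \<in> Obj D. ar R (adj_counit R v) \<cdot>\<^bsub>C\<^esub> adj_unit R (ob R v) = ident C (ob R v))"

section \<open>Size, colimits, local presentability\<close>

text \<open>
  Smallness is relative to an inaccessible cardinal \<open>\<kappa>\<close>, i.e. a Grothendieck universe.
  Since \<open>\<kappa>\<close> is a cardinal order on a subset of a type, small index categories and small
  posets can be taken, up to isomorphism, to live on that type.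
\<close>

definition regular_cardinal :: "'u rel \<Rightarrow> bool" where
  "regular_cardinal \<theta> \<longleftrightarrow> Card_order \<theta> \<and> \<not> finite (Field \<theta>) \<and> regularCard \<theta>"

definition inaccessible :: "'u rel \<Rightarrow> bool" where
  "inaccessible \<kappa> \<longleftrightarrow> regular_cardinal \<kappa> \<and> natLeq <o \<kappa> \<and>
     (\<forall>A :: 'u set. |A| <o \<kappa> \<longrightarrow> |Pow A| <o \<kappa>)"

definition small :: "'u rel \<Rightarrow> 'a set \<Rightarrow> bool" where
  "small \<kappa> A \<longleftrightarrow> |A| <o \<kappa>"

definition is_cocone ::
  "('i, 'j, 'y) cat_scheme \<Rightarrow> ('o, 'm, 'z) cat_scheme \<Rightarrow> ('i, 'j, 'o, 'm, 'w) func_scheme \<Rightarrow>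
   'o \<Rightarrow> ('i \<Rightarrow> 'm) \<Rightarrow> bool" where
  "is_cocone J C G c \<iota> \<longleftrightarrow> c \<in> Obj C \<and> (\<forall>j \<in> Obj J. \<iota> j \<in> Hom C (ob G j) c) \<and>
     (\<forall>u \<in> Arr J. \<iota> (target J u) \<cdot>\<^bsub>C\<^esub> ar G u = \<iota> (source J u))"

definition is_colimit ::
  "('i, 'j, 'y) cat_scheme \<Rightarrow> ('o, 'm, 'z) cat_scheme \<Rightarrow> ('i, 'j, 'o, 'm, 'w) func_scheme \<Rightarrow>
   'o \<Rightarrow> ('i \<Rightarrow> 'm) \<Rightarrow> bool" where
  "is_colimit J C G c \<iota> \<longleftrightarrow> is_functor J C G \<and> is_cocone J C G c \<iota> \<and>
     (\<forall>c' \<iota>'. is_cocone J C G c' \<iota>' \<longrightarrow>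
        (\<exists>!h. h \<in> Hom C c c' \<and> (\<forall>j \<in> Obj J. h \<cdot>\<^bsub>C\<^esub> \<iota> j = \<iota>' j)))"

definition small_category :: "'u rel \<Rightarrow> ('i, 'j, 'y) cat_scheme \<Rightarrow> bool" where
  "small_category \<kappa> J \<longleftrightarrow> category J \<and> small \<kappa> (Obj J) \<and> small \<kappa> (Arr J)"

definition cocomplete :: "'u rel \<Rightarrow> ('o, 'm, 'z) cat_scheme \<Rightarrow> bool" where
  "cocomplete \<kappa> C \<longleftrightarrow> category C \<and>
     (\<forall>(J :: ('u, 'u) cat) (G :: ('u, 'u, 'o, 'm) func).
        small_category \<kappa> J \<and> is_functor J C G \<longrightarrow> (\<exists>c \<iota>. is_colimit J C G c \<iota>))"

definition preserves_colimits ::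
  "'u rel \<Rightarrow> ('o1, 'm1, 'z1) cat_scheme \<Rightarrow> ('o2, 'm2, 'z2) cat_scheme \<Rightarrow>
   ('o1, 'm1, 'o2, 'm2, 'y) func_scheme \<Rightarrow> bool" where
  "preserves_colimits \<kappa> C D F \<longleftrightarrow> is_functor C D F \<and>
     (\<forall>(J :: ('u, 'u) cat) (G :: ('u, 'u, 'o1, 'm1) func) c \<iota>.
        small_category \<kappa> J \<and> is_colimit J C G c \<iota> \<longrightarrow>
        is_colimit J D (comp_func F G) (ob F c) (\<lambda>j. ar F (\<iota> j)))"

definition poset_cat :: "'u set \<Rightarrow> 'u rel \<Rightarrow> ('u, 'u \<times> 'u) cat" where
  "poset_cat P r = \<lparr>Obj = P, Arr = r, source = fst, target = snd,
     ident = (\<lambda>i. (i, i)), cmp = (\<lambda>v u. (fst u, snd v))\<rparr>"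

definition small_directed_poset :: "'u rel \<Rightarrow> 'u rel \<Rightarrow> 'u set \<Rightarrow> 'u rel \<Rightarrow> bool" where
  "small_directed_poset \<kappa> \<theta> P r \<longleftrightarrow> small \<kappa> P \<and> r \<subseteq> P \<times> P \<and> partial_order_on P r \<and>
     (\<forall>S \<subseteq> P. |S| <o \<theta> \<longrightarrow> (\<exists>b \<in> P. \<forall>a \<in> S. (a, b) \<in> r))"

text \<open>
  \<open>K\<close> is \<open>\<theta>\<close>-presentable if \<open>Hom(K, -)\<close> preserves small \<open>\<theta>\<close>-directed colimits. The two
  clauses express that the canonical map \<open>colim Hom(K, G i) \<rightarrow> Hom(K, c)\<close> is surjective and
  injective, the colimit of sets being the disjoint union of the \<open>Hom(K, G i)\<close> in which two
  elements are identified iff their images agree at some later stage.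
\<close>

definition presentable_object ::
  "'u rel \<Rightarrow> 'u rel \<Rightarrow> ('o, 'm, 'z) cat_scheme \<Rightarrow> 'o \<Rightarrow> bool" where
  "presentable_object \<kappa> \<theta> C K \<longleftrightarrow> K \<in> Obj C \<and>
     (\<forall>P r (G :: ('u, 'u \<times> 'u, 'o, 'm) func) c \<iota>.
        small_directed_poset \<kappa> \<theta> P r \<and> is_colimit (poset_cat P r) C G c \<iota> \<longrightarrow>
        (\<forall>f \<in> Hom C K c. \<exists>i \<in> P. \<exists>f' \<in> Hom C K (ob G i). f = \<iota> i \<cdot>\<^bsub>C\<^esub> f') \<and>
        (\<forall>i \<in> P. \<forall>j \<in> P. \<forall>f \<in> Hom C K (ob G i). \<forall>g \<in> Hom C K (ob G j).
           \<iota> i \<cdot>\<^bsub>C\<^esub> f = \<iota> j \<cdot>\<^bsub>C\<^esub> g \<longrightarrow>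
           (\<exists>l \<in> P. (i, l) \<in> r \<and> (j, l) \<in> r \<and>
              ar G (i, l) \<cdot>\<^bsub>C\<^esub> f = ar G (j, l) \<cdot>\<^bsub>C\<^esub> g)))"

definition locally_presentable :: "'u rel \<Rightarrow> ('o, 'm, 'z) cat_scheme \<Rightarrow> bool" where
  "locally_presentable \<kappa> C \<longleftrightarrow> category C \<and>
     (\<forall>x \<in> Obj C. \<forall>y \<in> Obj C. small \<kappa> (Hom C x y)) \<and> cocomplete \<kappa> C \<and>
     (\<exists>(\<theta> :: 'u rel) S. regular_cardinal \<theta> \<and> \<theta> <o \<kappa> \<and> small \<kappa> S \<and>
        (\<forall>K \<in> S. presentable_object \<kappa> \<theta> C K) \<and>
        (\<forall>x \<in> Obj C. \<exists>P r (G :: ('u, 'u \<times> 'u, 'o, 'm) func) \<iota>.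
           small_directed_poset \<kappa> \<theta> P r \<and> (\<forall>i \<in> P. ob G i \<in> S) \<and>
           is_colimit (poset_cat P r) C G x \<iota>))"

section \<open>Linear categories\<close>

text \<open>The module structure on \<open>Hom x y\<close> is a \<open>module\<close> record with that carrier; its unused
  multiplication fields are irrelevant.\<close>

record ('o, 'm, 'k) lincat = "('o, 'm) cat" +
  hom_module :: "'o \<Rightarrow> 'o \<Rightarrow> ('k, 'm) module"

definition linear_map ::
  "('k, 'w) ring_scheme \<Rightarrow> ('k, 'm) module \<Rightarrow> ('k, 'n) module \<Rightarrow> ('m \<Rightarrow> 'n) \<Rightarrow> bool" where
  "linear_map k M N h \<longleftrightarrow> h \<in> carrier M \<rightarrow> carrier N \<and>
     (\<forall>x \<in> carrier M. \<forall>y \<in> carrier M. h (x \<oplus>\<^bsub>M\<^esub> y) = h x \<oplus>\<^bsub>N\<^esub> h y) \<and>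
     (\<forall>a \<in> carrier k. \<forall>x \<in> carrier M. h (a \<odot>\<^bsub>M\<^esub> x) = a \<odot>\<^bsub>N\<^esub> h x)"

locale linear_category = category C + cring k
  for k :: "('k, 'w) ring_scheme" and C :: "('o, 'm, 'k, 'z) lincat_scheme" +
  assumes hom_module: "\<lbrakk>x \<in> Obj C; y \<in> Obj C\<rbrakk> \<Longrightarrow> module k (hom_module C x y)"
    and hom_carrier: "\<lbrakk>x \<in> Obj C; y \<in> Obj C\<rbrakk> \<Longrightarrow> carrier (hom_module C x y) = Hom C x y"
    and cmp_linear_left: "\<lbrakk>x \<in> Obj C; y \<in> Obj C; z \<in> Obj C; f \<in> Hom C x y\<rbrakk>
      \<Longrightarrow> linear_map k (hom_module C y z) (hom_module C x z) (\<lambda>g. g \<cdot>\<^bsub>C\<^esub> f)"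
    and cmp_linear_right: "\<lbrakk>x \<in> Obj C; y \<in> Obj C; z \<in> Obj C; g \<in> Hom C y z\<rbrakk>
      \<Longrightarrow> linear_map k (hom_module C x y) (hom_module C x z) (\<lambda>f. g \<cdot>\<^bsub>C\<^esub> f)"

definition linear_functor ::
  "('k, 'w) ring_scheme \<Rightarrow> ('o1, 'm1, 'k, 'z1) lincat_scheme \<Rightarrow>
   ('o2, 'm2, 'k, 'z2) lincat_scheme \<Rightarrow> ('o1, 'm1, 'o2, 'm2, 'y) func_scheme \<Rightarrow> bool" where
  "linear_functor k C D F \<longleftrightarrow> is_functor C D F \<and>
     (\<forall>x \<in> Obj C. \<forall>y \<in> Obj C.
        linear_map k (hom_module C x y) (hom_module D (ob F x) (ob F y)) (ar F))"

section \<open>Monoidal and braided categories\<close>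

record ('o, 'm, 'k) moncat = "('o, 'm, 'k) lincat" +
  tens_ob :: "'o \<Rightarrow> 'o \<Rightarrow> 'o"  (infixl \<open>\<star>\<index>\<close> 75)
  tens_ar :: "'m \<Rightarrow> 'm \<Rightarrow> 'm"  (infixl \<open>\<bullet>\<index>\<close> 75)
  unit_ob :: "'o"  (\<open>\<I>\<index>\<close>)
  asc :: "'o \<Rightarrow> 'o \<Rightarrow> 'o \<Rightarrow> 'm"
  lun :: "'o \<Rightarrow> 'm"
  run :: "'o \<Rightarrow> 'm"

locale monoidal_category = category C
  for C :: "('o, 'm, 'k, 'z) moncat_scheme" (structure) +
  assumes tens_ob_closed: "\<lbrakk>x \<in> Obj C; y \<in> Obj C\<rbrakk> \<Longrightarrow> x \<star> y \<in> Obj C"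
    and tens_ar_closed: "\<lbrakk>f \<in> Hom C x x'; g \<in> Hom C y y'\<rbrakk> \<Longrightarrow> f \<bullet> g \<in> Hom C (x \<star> y) (x' \<star> y')"
    and tens_ident: "\<lbrakk>x \<in> Obj C; y \<in> Obj C\<rbrakk> \<Longrightarrow> ident C x \<bullet> ident C y = ident C (x \<star> y)"
    and tens_cmp: "\<lbrakk>f \<in> Hom C x x'; f' \<in> Hom C x' x''; g \<in> Hom C y y'; g' \<in> Hom C y' y''\<rbrakk>
      \<Longrightarrow> (f' \<cdot> f) \<bullet> (g' \<cdot> g) = f' \<bullet> g' \<cdot> f \<bullet> g"
    and unit_ob_closed: "\<I> \<in> Obj C"
    and asc_closed: "\<lbrakk>x \<in> Obj C; y \<in> Obj C; z \<in> Obj C\<rbrakk>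
      \<Longrightarrow> asc C x y z \<in> Hom C ((x \<star> y) \<star> z) (x \<star> (y \<star> z)) \<and> is_iso C (asc C x y z)"
    and asc_natural: "\<lbrakk>f \<in> Hom C x x'; g \<in> Hom C y y'; h \<in> Hom C z z'\<rbrakk>
      \<Longrightarrow> asc C x' y' z' \<cdot> (f \<bullet> g) \<bullet> h = f \<bullet> (g \<bullet> h) \<cdot> asc C x y z"
    and lun_closed: "x \<in> Obj C \<Longrightarrow> lun C x \<in> Hom C (\<I> \<star> x) x \<and> is_iso C (lun C x)"
    and lun_natural: "f \<in> Hom C x y \<Longrightarrow> lun C y \<cdot> ident C \<I> \<bullet> f = f \<cdot> lun C x"
    and run_closed: "x \<in> Obj C \<Longrightarrow> run C x \<in> Hom C (x \<star> \<I>) x \<and> is_iso C (run C x)"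
    and run_natural: "f \<in> Hom C x y \<Longrightarrow> run C y \<cdot> f \<bullet> ident C \<I> = f \<cdot> run C x"
    and pentagon: "\<lbrakk>w \<in> Obj C; x \<in> Obj C; y \<in> Obj C; z \<in> Obj C\<rbrakk>
      \<Longrightarrow> asc C w x (y \<star> z) \<cdot> asc C (w \<star> x) y z =
          ident C w \<bullet> asc C x y z \<cdot> asc C w (x \<star> y) z \<cdot> asc C w x y \<bullet> ident C z"
    and triangle: "\<lbrakk>x \<in> Obj C; y \<in> Obj C\<rbrakk>
      \<Longrightarrow> ident C x \<bullet> lun C y \<cdot> asc C x \<I> y = run C x \<bullet> ident C y"

definition tens_left ::
  "('o, 'm, 'k, 'z) moncat_scheme \<Rightarrow> 'o \<Rightarrow> ('o, 'm, 'o, 'm) func" where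
  "tens_left C x = \<lparr>ob = (\<lambda>y. x \<star>\<^bsub>C\<^esub> y), ar = (\<lambda>f. ident C x \<bullet>\<^bsub>C\<^esub> f)\<rparr>"

definition tens_right ::
  "('o, 'm, 'k, 'z) moncat_scheme \<Rightarrow> 'o \<Rightarrow> ('o, 'm, 'o, 'm) func" where
  "tens_right C x = \<lparr>ob = (\<lambda>y. y \<star>\<^bsub>C\<^esub> x), ar = (\<lambda>f. f \<bullet>\<^bsub>C\<^esub> ident C x)\<rparr>"

text \<open>The standing assumptions on monoidal categories.\<close>

locale presentable_monoidal_category = monoidal_category C + linear_category k C
  for \<kappa> :: "'u rel" and k :: "('k, 'w) ring_scheme" and C :: "('o, 'm, 'k, 'z) moncat_scheme" +
  assumes tens_linear_left: "\<lbrakk>x \<in> Obj C; x' \<in> Obj C; y \<in> Obj C; y' \<in> Obj C; g \<in> Hom C y y'\<rbrakk>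
      \<Longrightarrow> linear_map k (hom_module C x x') (hom_module C (x \<star>\<^bsub>C\<^esub> y) (x' \<star>\<^bsub>C\<^esub> y')) (\<lambda>f. f \<bullet>\<^bsub>C\<^esub> g)"
    and tens_linear_right: "\<lbrakk>x \<in> Obj C; x' \<in> Obj C; y \<in> Obj C; y' \<in> Obj C; f \<in> Hom C x x'\<rbrakk>
      \<Longrightarrow> linear_map k (hom_module C y y') (hom_module C (x \<star>\<^bsub>C\<^esub> y) (x' \<star>\<^bsub>C\<^esub> y')) (\<lambda>g. f \<bullet>\<^bsub>C\<^esub> g)"
    and presentable: "locally_presentable \<kappa> C"
    and tens_left_colimits: "x \<in> Obj C \<Longrightarrow> preserves_colimits \<kappa> C C (tens_left C x)"
    and tens_right_colimits: "x \<in> Obj C \<Longrightarrow> preserves_colimits \<kappa> C C (tens_right C x)"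

record ('o, 'm, 'k) brcat = "('o, 'm, 'k) moncat" +
  braid :: "'o \<Rightarrow> 'o \<Rightarrow> 'm"

locale braided_category = monoidal_category C
  for C :: "('o, 'm, 'k, 'z) brcat_scheme" (structure) +
  assumes braid_closed: "\<lbrakk>x \<in> Obj C; y \<in> Obj C\<rbrakk>
      \<Longrightarrow> braid C x y \<in> Hom C (x \<star> y) (y \<star> x) \<and> is_iso C (braid C x y)"
    and braid_natural: "\<lbrakk>f \<in> Hom C x x'; g \<in> Hom C y y'\<rbrakk>
      \<Longrightarrow> braid C x' y' \<cdot> f \<bullet> g = g \<bullet> f \<cdot> braid C x y"
    and hexagon_right: "\<lbrakk>x \<in> Obj C; y \<in> Obj C; z \<in> Obj C\<rbrakk>
      \<Longrightarrow> asc C y z x \<cdot> braid C x (y \<star> z) \<cdot> asc C x y z =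
          ident C y \<bullet> braid C x z \<cdot> asc C y x z \<cdot> braid C x y \<bullet> ident C z"
    and hexagon_left: "\<lbrakk>x \<in> Obj C; y \<in> Obj C; z \<in> Obj C\<rbrakk>
      \<Longrightarrow> braid C (x \<star> y) z =
          asc C z x y \<cdot> braid C x z \<bullet> ident C y \<cdot> inverse_arr C (asc C x z y) \<cdot>
          ident C x \<bullet> braid C y z \<cdot> asc C x y z"

record ('o1, 'm1, 'o2, 'm2) monfunc = "('o1, 'm1, 'o2, 'm2) func" +
  fmult :: "'o1 \<Rightarrow> 'o1 \<Rightarrow> 'm2"
  funit :: "'m2"

text \<open>Strong monoidal functors, with \<open>fmult T x y : T x \<otimes> T y \<rightarrow> T (x \<otimes> y)\<close> and
  \<open>funit T : 1 \<rightarrow> T 1\<close>.\<close>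

definition monoidal_functor ::
  "('o1, 'm1, 'k, 'z1) moncat_scheme \<Rightarrow> ('o2, 'm2, 'k, 'z2) moncat_scheme \<Rightarrow>
   ('o1, 'm1, 'o2, 'm2, 'y) monfunc_scheme \<Rightarrow> bool" where
  "monoidal_functor C D T \<longleftrightarrow> is_functor C D T \<and>
     (\<forall>x \<in> Obj C. \<forall>y \<in> Obj C.
        fmult T x y \<in> Hom D (ob T x \<star>\<^bsub>D\<^esub> ob T y) (ob T (x \<star>\<^bsub>C\<^esub> y)) \<and> is_iso D (fmult T x y)) \<and>
     funit T \<in> Hom D \<I>\<^bsub>D\<^esub> (ob T \<I>\<^bsub>C\<^esub>) \<and> is_iso D (funit T) \<and>
     (\<forall>x \<in> Obj C. \<forall>x' \<in> Obj C. \<forall>y \<in> Obj C. \<forall>y' \<in> Obj C. \<forall>f \<in> Hom C x x'. \<forall>g \<in> Hom C y y'.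
        fmult T x' y' \<cdot>\<^bsub>D\<^esub> ar T f \<bullet>\<^bsub>D\<^esub> ar T g = ar T (f \<bullet>\<^bsub>C\<^esub> g) \<cdot>\<^bsub>D\<^esub> fmult T x y) \<and>
     (\<forall>x \<in> Obj C. \<forall>y \<in> Obj C. \<forall>z \<in> Obj C.
        ar T (asc C x y z) \<cdot>\<^bsub>D\<^esub> fmult T (x \<star>\<^bsub>C\<^esub> y) z \<cdot>\<^bsub>D\<^esub> fmult T x y \<bullet>\<^bsub>D\<^esub> ident D (ob T z) =
        fmult T x (y \<star>\<^bsub>C\<^esub> z) \<cdot>\<^bsub>D\<^esub> ident D (ob T x) \<bullet>\<^bsub>D\<^esub> fmult T y z \<cdot>\<^bsub>D\<^esub>
          asc D (ob T x) (ob T y) (ob T z)) \<and>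
     (\<forall>x \<in> Obj C.
        ar T (lun C x) \<cdot>\<^bsub>D\<^esub> fmult T \<I>\<^bsub>C\<^esub> x \<cdot>\<^bsub>D\<^esub> funit T \<bullet>\<^bsub>D\<^esub> ident D (ob T x) = lun D (ob T x)) \<and>
     (\<forall>x \<in> Obj C.
        ar T (run C x) \<cdot>\<^bsub>D\<^esub> fmult T x \<I>\<^bsub>C\<^esub> \<cdot>\<^bsub>D\<^esub> ident D (ob T x) \<bullet>\<^bsub>D\<^esub> funit T = run D (ob T x))"

section \<open>The Drinfeld center and quantum Manin pairs\<close>

definition half_braiding ::
  "('o, 'm, 'k, 'z) moncat_scheme \<Rightarrow> 'o \<Rightarrow> ('o \<Rightarrow> 'm) \<Rightarrow> bool" where
  "half_braiding D x \<beta> \<longleftrightarrow>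
     (\<forall>v \<in> Obj D. \<beta> v \<in> Hom D (x \<star>\<^bsub>D\<^esub> v) (v \<star>\<^bsub>D\<^esub> x) \<and> is_iso D (\<beta> v)) \<and>
     (\<forall>v \<in> Obj D. \<forall>w \<in> Obj D. \<forall>f \<in> Hom D v w.
        \<beta> w \<cdot>\<^bsub>D\<^esub> ident D x \<bullet>\<^bsub>D\<^esub> f = f \<bullet>\<^bsub>D\<^esub> ident D x \<cdot>\<^bsub>D\<^esub> \<beta> v) \<and>
     (\<forall>v \<in> Obj D. \<forall>w \<in> Obj D.
        asc D v w x \<cdot>\<^bsub>D\<^esub> \<beta> (v \<star>\<^bsub>D\<^esub> w) \<cdot>\<^bsub>D\<^esub> asc D x v w =
        ident D v \<bullet>\<^bsub>D\<^esub> \<beta> w \<cdot>\<^bsub>D\<^esub> asc D v x w \<cdot>\<^bsub>D\<^esub> \<beta> v \<bullet>\<^bsub>D\<^esub> ident D w) \<and>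
     lun D x \<cdot>\<^bsub>D\<^esub> \<beta> \<I>\<^bsub>D\<^esub> = run D x"

text \<open>Half-braidings are made extensional so that equality of objects of the center is
  equality of half-braidings on \<open>Obj D\<close>.\<close>

definition center ::
  "('o, 'm, 'k, 'z) moncat_scheme \<Rightarrow>
   ('o \<times> ('o \<Rightarrow> 'm), ('o \<times> ('o \<Rightarrow> 'm)) \<times> 'm \<times> ('o \<times> ('o \<Rightarrow> 'm))) cat" where
  "center D =
     (let Ob = {(x, \<beta>). x \<in> Obj D \<and> half_braiding D x \<beta> \<and> \<beta> \<in> extensional (Obj D)} in
      \<lparr>Obj = Ob,
       Arr = {(p, f, q). p \<in> Ob \<and> q \<in> Ob \<and> f \<in> Hom D (fst p) (fst q) \<and>
          (\<forall>v \<in> Obj D. snd q v \<cdot>\<^bsub>D\<^esub> f \<bullet>\<^bsub>D\<^esub> ident D v = ident D v \<bullet>\<^bsub>D\<^esub> f \<cdot>\<^bsub>D\<^esub> snd p v)},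
       source = fst,
       target = (\<lambda>(p, f, q). q),
       ident = (\<lambda>p. (p, ident D (fst p), p)),
       cmp = (\<lambda>(q', g, r) (p, f, q). (p, g \<cdot>\<^bsub>D\<^esub> f, r))\<rparr>)"

definition lift_to_center ::
  "('oc, 'mc, 'z1) cat_scheme \<Rightarrow> ('od, 'md, 'k, 'z2) moncat_scheme \<Rightarrow>
   ('oc, 'mc, 'od, 'md, 'y) func_scheme \<Rightarrow> ('oc \<Rightarrow> 'od \<Rightarrow> 'md) \<Rightarrow>
   ('oc, 'mc, 'od \<times> ('od \<Rightarrow> 'md),
    ('od \<times> ('od \<Rightarrow> 'md)) \<times> 'md \<times> ('od \<times> ('od \<Rightarrow> 'md))) func" where
  "lift_to_center C D T \<tau> =
     (let L = (\<lambda>x. (ob T x, restrict (\<tau> x) (Obj D))) in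
      \<lparr>ob = L, ar = (\<lambda>f. (L (source C f), ar T f, L (target C f)))\<rparr>)"

text \<open>
  The colimit-preserving braided monoidal functor from \<open>C\<close> to the center of \<open>D\<close> is given by the
  monoidal functor \<open>T\<close> and the isomorphisms \<open>\<tau> x v : T x \<otimes> v \<rightarrow> v \<otimes> T x\<close>.
\<close>

locale quantum_manin_pair =
  C: presentable_monoidal_category \<kappa> k C + D: presentable_monoidal_category \<kappa> k D +
  braided_category C
  for \<kappa> :: "'u rel" and k :: "('k, 'w) ring_scheme"
    and C :: "('oc, 'mc, 'k, 'z1) brcat_scheme" and D :: "('od, 'md, 'k, 'z2) moncat_scheme"
    and T :: "('oc, 'mc, 'od, 'md) monfunc" and \<tau> :: "'oc \<Rightarrow> 'od \<Rightarrow> 'md" +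
  assumes monoidal: "monoidal_functor C D T"
    and linear: "linear_functor k C D T"
    and half_braidings: "x \<in> Obj C \<Longrightarrow> half_braiding D (ob T x) (\<tau> x)"
    and \<tau>_natural: "\<lbrakk>x \<in> Obj C; y \<in> Obj C; f \<in> Hom C x y; v \<in> Obj D\<rbrakk>
      \<Longrightarrow> \<tau> y v \<cdot>\<^bsub>D\<^esub> ar T f \<bullet>\<^bsub>D\<^esub> ident D v = ident D v \<bullet>\<^bsub>D\<^esub> ar T f \<cdot>\<^bsub>D\<^esub> \<tau> x v"
    and \<tau>_tensor: "\<lbrakk>x \<in> Obj C; y \<in> Obj C; v \<in> Obj D\<rbrakk>
      \<Longrightarrow> \<tau> (x \<star>\<^bsub>C\<^esub> y) v \<cdot>\<^bsub>D\<^esub> fmult T x y \<bullet>\<^bsub>D\<^esub> ident D v =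
          ident D v \<bullet>\<^bsub>D\<^esub> fmult T x y \<cdot>\<^bsub>D\<^esub> asc D v (ob T x) (ob T y) \<cdot>\<^bsub>D\<^esub>
          \<tau> x v \<bullet>\<^bsub>D\<^esub> ident D (ob T y) \<cdot>\<^bsub>D\<^esub> inverse_arr D (asc D (ob T x) v (ob T y)) \<cdot>\<^bsub>D\<^esub>
          ident D (ob T x) \<bullet>\<^bsub>D\<^esub> \<tau> y v \<cdot>\<^bsub>D\<^esub> asc D (ob T x) (ob T y) v"
    and \<tau>_unit: "v \<in> Obj D
      \<Longrightarrow> run D v \<cdot>\<^bsub>D\<^esub> ident D v \<bullet>\<^bsub>D\<^esub> inverse_arr D (funit T) \<cdot>\<^bsub>D\<^esub> \<tau> \<I>\<^bsub>C\<^esub> v \<cdot>\<^bsub>D\<^esub>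
          funit T \<bullet>\<^bsub>D\<^esub> ident D v = lun D v"
    and \<tau>_braid: "\<lbrakk>x \<in> Obj C; y \<in> Obj C\<rbrakk>
      \<Longrightarrow> fmult T y x \<cdot>\<^bsub>D\<^esub> \<tau> x (ob T y) = ar T (braid C x y) \<cdot>\<^bsub>D\<^esub> fmult T x y"
    and colimits: "preserves_colimits \<kappa> C (center D) (lift_to_center C D T \<tau>)"

section \<open>The lax monoidal structure of the right adjoint\<close>

definition lax_mult ::
  "('oc, 'mc, 'k, 'z1) moncat_scheme \<Rightarrow> ('od, 'md, 'k, 'z2) moncat_scheme \<Rightarrow>
   ('oc, 'mc, 'od, 'md) monfunc \<Rightarrow> ('oc, 'mc, 'od, 'md) radj \<Rightarrow> 'od \<Rightarrow> 'od \<Rightarrow> 'mc" where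
  "lax_mult C D T R v w =
     ar R (adj_counit R v \<bullet>\<^bsub>D\<^esub> adj_counit R w \<cdot>\<^bsub>D\<^esub> inverse_arr D (fmult T (ob R v) (ob R w)))
     \<cdot>\<^bsub>C\<^esub> adj_unit R (ob R v \<star>\<^bsub>C\<^esub> ob R w)"

definition lax_unit ::
  "('oc, 'mc, 'k, 'z1) moncat_scheme \<Rightarrow> ('od, 'md, 'k, 'z2) moncat_scheme \<Rightarrow>
   ('oc, 'mc, 'od, 'md) monfunc \<Rightarrow> ('oc, 'mc, 'od, 'md) radj \<Rightarrow> 'mc" where
  "lax_unit C D T R = ar R (inverse_arr D (funit T)) \<cdot>\<^bsub>C\<^esub> adj_unit R \<I>\<^bsub>C\<^esub>"

definition projection_map ::
  "('oc, 'mc, 'k, 'z1) moncat_scheme \<Rightarrow> ('od, 'md, 'k, 'z2) moncat_scheme \<Rightarrow>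
   ('oc, 'mc, 'od, 'md) monfunc \<Rightarrow> ('oc, 'mc, 'od, 'md) radj \<Rightarrow> 'oc \<Rightarrow> 'od \<Rightarrow> 'mc" where
  "projection_map C D T R x v =
     lax_mult C D T R (ob T x) v \<cdot>\<^bsub>C\<^esub> adj_unit R x \<bullet>\<^bsub>C\<^esub> ident C (ob R v)"

definition projection_formula ::
  "('oc, 'mc, 'k, 'z1) moncat_scheme \<Rightarrow> ('od, 'md, 'k, 'z2) moncat_scheme \<Rightarrow>
   ('oc, 'mc, 'od, 'md) monfunc \<Rightarrow> ('oc, 'mc, 'od, 'md) radj \<Rightarrow> bool" where
  "projection_formula C D T R \<longleftrightarrow>
     (\<forall>x \<in> Obj C. \<forall>v \<in> Obj D. is_iso C (projection_map C D T R x v))"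

section \<open>Algebras and modules\<close>

record ('o, 'm) alg =
  alg_ob :: "'o"
  alg_mult :: "'m"
  alg_unit :: "'m"

definition is_algebra ::
  "('o, 'm, 'k, 'z) moncat_scheme \<Rightarrow> ('o, 'm) alg \<Rightarrow> bool" where
  "is_algebra C A \<longleftrightarrow> alg_ob A \<in> Obj C \<and>
     alg_mult A \<in> Hom C (alg_ob A \<star>\<^bsub>C\<^esub> alg_ob A) (alg_ob A) \<and>
     alg_unit A \<in> Hom C \<I>\<^bsub>C\<^esub> (alg_ob A) \<and>
     alg_mult A \<cdot>\<^bsub>C\<^esub> alg_mult A \<bullet>\<^bsub>C\<^esub> ident C (alg_ob A) =
       alg_mult A \<cdot>\<^bsub>C\<^esub> ident C (alg_ob A) \<bullet>\<^bsub>C\<^esub> alg_mult A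
         \<cdot>\<^bsub>C\<^esub> asc C (alg_ob A) (alg_ob A) (alg_ob A) \<and>
     alg_mult A \<cdot>\<^bsub>C\<^esub> alg_unit A \<bullet>\<^bsub>C\<^esub> ident C (alg_ob A) = lun C (alg_ob A) \<and>
     alg_mult A \<cdot>\<^bsub>C\<^esub> ident C (alg_ob A) \<bullet>\<^bsub>C\<^esub> alg_unit A = run C (alg_ob A)"

definition algebra_map ::
  "('o, 'm, 'k, 'z) moncat_scheme \<Rightarrow> ('o, 'm) alg \<Rightarrow> ('o, 'm) alg \<Rightarrow> 'm \<Rightarrow> bool" where
  "algebra_map C A B h \<longleftrightarrow> h \<in> Hom C (alg_ob A) (alg_ob B) \<and>
     h \<cdot>\<^bsub>C\<^esub> alg_mult A = alg_mult B \<cdot>\<^bsub>C\<^esub> h \<bullet>\<^bsub>C\<^esub> h \<and>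
     h \<cdot>\<^bsub>C\<^esub> alg_unit A = alg_unit B"

definition unit_algebra :: "('o, 'm, 'k, 'z) moncat_scheme \<Rightarrow> ('o, 'm) alg" where
  "unit_algebra C = \<lparr>alg_ob = \<I>\<^bsub>C\<^esub>, alg_mult = lun C \<I>\<^bsub>C\<^esub>, alg_unit = ident C \<I>\<^bsub>C\<^esub>\<rparr>"

definition image_algebra ::
  "('od, 'md, 'k, 'z2) moncat_scheme \<Rightarrow> ('oc, 'mc, 'od, 'md) monfunc \<Rightarrow>
   ('oc, 'mc) alg \<Rightarrow> ('od, 'md) alg" where
  "image_algebra D T B =
     \<lparr>alg_ob = ob T (alg_ob B),
      alg_mult = ar T (alg_mult B) \<cdot>\<^bsub>D\<^esub> fmult T (alg_ob B) (alg_ob B),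
      alg_unit = ar T (alg_unit B) \<cdot>\<^bsub>D\<^esub> funit T\<rparr>"

definition radj_algebra ::
  "('oc, 'mc, 'k, 'z1) moncat_scheme \<Rightarrow> ('od, 'md, 'k, 'z2) moncat_scheme \<Rightarrow>
   ('oc, 'mc, 'od, 'md) monfunc \<Rightarrow> ('oc, 'mc, 'od, 'md) radj \<Rightarrow>
   ('od, 'md) alg \<Rightarrow> ('oc, 'mc) alg" where
  "radj_algebra C D T R A =
     \<lparr>alg_ob = ob R (alg_ob A),
      alg_mult = ar R (alg_mult A) \<cdot>\<^bsub>C\<^esub> lax_mult C D T R (alg_ob A) (alg_ob A),
      alg_unit = ar R (alg_unit A) \<cdot>\<^bsub>C\<^esub> lax_unit C D T R\<rparr>"

definition is_left_module ::
  "('o, 'm, 'k, 'z) moncat_scheme \<Rightarrow> ('o, 'm) alg \<Rightarrow> 'o \<times> 'm \<Rightarrow> bool" where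
  "is_left_module C A = (\<lambda>(M, a). M \<in> Obj C \<and> a \<in> Hom C (alg_ob A \<star>\<^bsub>C\<^esub> M) M \<and>
     a \<cdot>\<^bsub>C\<^esub> alg_mult A \<bullet>\<^bsub>C\<^esub> ident C M =
       a \<cdot>\<^bsub>C\<^esub> ident C (alg_ob A) \<bullet>\<^bsub>C\<^esub> a \<cdot>\<^bsub>C\<^esub> asc C (alg_ob A) (alg_ob A) M \<and>
     a \<cdot>\<^bsub>C\<^esub> alg_unit A \<bullet>\<^bsub>C\<^esub> ident C M = lun C M)"

definition LMod ::
  "('o, 'm, 'k, 'z) moncat_scheme \<Rightarrow> ('o, 'm) alg \<Rightarrow>
   ('o \<times> 'm, ('o \<times> 'm) \<times> 'm \<times> ('o \<times> 'm)) cat" where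
  "LMod C A =
     \<lparr>Obj = {p. is_left_module C A p},
      Arr = {(p, f, q). is_left_module C A p \<and> is_left_module C A q \<and> f \<in> Hom C (fst p) (fst q) \<and>
         f \<cdot>\<^bsub>C\<^esub> snd p = snd q \<cdot>\<^bsub>C\<^esub> ident C (alg_ob A) \<bullet>\<^bsub>C\<^esub> f},
      source = fst,
      target = (\<lambda>(p, f, q). q),
      ident = (\<lambda>p. (p, ident C (fst p), p)),
      cmp = (\<lambda>(q', g, r) (p, f, q). (p, g \<cdot>\<^bsub>C\<^esub> f, r))\<rparr>"

text \<open>The \<open>R 1\<close>-action on \<open>R v\<close> is \<open>R 1 \<otimes> R v \<rightarrow> R (1 \<otimes> v) \<cong> R v\<close>.\<close>

definition comparison_functor ::
  "('oc, 'mc, 'k, 'z1) moncat_scheme \<Rightarrow> ('od, 'md, 'k, 'z2) moncat_scheme \<Rightarrow>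
   ('oc, 'mc, 'od, 'md) monfunc \<Rightarrow> ('oc, 'mc, 'od, 'md) radj \<Rightarrow>
   ('od, 'md, 'oc \<times> 'mc, ('oc \<times> 'mc) \<times> 'mc \<times> ('oc \<times> 'mc)) func" where
  "comparison_functor C D T R =
     (let L = (\<lambda>v. (ob R v, ar R (lun D v) \<cdot>\<^bsub>C\<^esub> lax_mult C D T R \<I>\<^bsub>D\<^esub> v)) in
      \<lparr>ob = L, ar = (\<lambda>f. (L (source D f), ar R f, L (target D f)))\<rparr>)"

definition monadic ::
  "('oc, 'mc, 'k, 'z1) moncat_scheme \<Rightarrow> ('od, 'md, 'k, 'z2) moncat_scheme \<Rightarrow>
   ('oc, 'mc, 'od, 'md) monfunc \<Rightarrow> ('oc, 'mc, 'od, 'md) radj \<Rightarrow> bool" where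
  "monadic C D T R \<longleftrightarrow>
     is_equivalence D (LMod C (radj_algebra C D T R (unit_algebra D))) (comparison_functor C D T R)"

section \<open>Quantum moment maps and central maps\<close>

definition moment_algebra ::
  "('oc, 'mc, 'k, 'z1) moncat_scheme \<Rightarrow> ('od, 'md, 'k, 'z2) moncat_scheme \<Rightarrow>
   ('oc, 'mc, 'od, 'md) monfunc \<Rightarrow> ('oc, 'mc, 'od, 'md) radj \<Rightarrow> ('od, 'md) alg" where
  "moment_algebra C D T R = image_algebra D T (radj_algebra C D T R (unit_algebra D))"

definition quantum_moment_map ::
  "('oc, 'mc, 'k, 'z1) moncat_scheme \<Rightarrow> ('od, 'md, 'k, 'z2) moncat_scheme \<Rightarrow>
   ('oc, 'mc, 'od, 'md) monfunc \<Rightarrow> ('oc \<Rightarrow> 'od \<Rightarrow> 'md) \<Rightarrow> ('oc, 'mc, 'od, 'md) radj \<Rightarrow>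
   ('od, 'md) alg \<Rightarrow> 'md \<Rightarrow> bool" where
  "quantum_moment_map C D T \<tau> R A \<mu> \<longleftrightarrow>
     algebra_map D (moment_algebra C D T R) A \<mu> \<and>
     alg_mult A \<cdot>\<^bsub>D\<^esub> \<mu> \<bullet>\<^bsub>D\<^esub> ident D (alg_ob A) =
     alg_mult A \<cdot>\<^bsub>D\<^esub> ident D (alg_ob A) \<bullet>\<^bsub>D\<^esub> \<mu> \<cdot>\<^bsub>D\<^esub> \<tau> (ob R \<I>\<^bsub>D\<^esub>) (alg_ob A)"

definition adjoint_map ::
  "('oc, 'mc, 'z) cat_scheme \<Rightarrow> ('oc, 'mc, 'od, 'md) radj \<Rightarrow> 'oc \<Rightarrow> 'md \<Rightarrow> 'mc" where
  "adjoint_map C R x h = ar R h \<cdot>\<^bsub>C\<^esub> adj_unit R x"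

definition is_central ::
  "('o, 'm, 'k, 'z) brcat_scheme \<Rightarrow> ('o, 'm) alg \<Rightarrow> ('o, 'm) alg \<Rightarrow> 'm \<Rightarrow> bool" where
  "is_central C B A h \<longleftrightarrow>
     alg_mult A \<cdot>\<^bsub>C\<^esub> h \<bullet>\<^bsub>C\<^esub> ident C (alg_ob A) =
     alg_mult A \<cdot>\<^bsub>C\<^esub> ident C (alg_ob A) \<bullet>\<^bsub>C\<^esub> h \<cdot>\<^bsub>C\<^esub> braid C (alg_ob B) (alg_ob A)"

end

theory Submission
  imports Defs
begin

text \<open>
  Transposing along \<open>T \<stileturn> R\<close> turns the two sides of the centrality equation into the two sides
  \<open>T R 1 \<otimes> A \<rightarrow> A\<close> of the moment map equation, precomposed with \<open>id \<otimes> \<epsilon>\<^sub>A\<close>; here \<open>\<tau>\<^bsub>X,T Y\<^esub> = T \<sigma>\<^bsub>X,Y\<^esub>\<close>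
  and the naturality of \<open>\<tau>\<close> in its second argument are used. It remains to cancel \<open>id \<otimes> \<epsilon>\<^sub>A\<close>.
  By the projection formula, \<open>R (id \<otimes> \<epsilon>\<^sub>A)\<close> is isomorphic to \<open>id \<otimes> R \<epsilon>\<^sub>A\<close>, which is split by
  \<open>id \<otimes> \<eta>\<^bsub>R A\<^esub>\<close>. Since \<open>R\<close> is faithful by monadicity, \<open>id \<otimes> \<epsilon>\<^sub>A\<close> is an epimorphism.
\<close>

section \<open>Arrows, composition and inverses in a category\<close>

lemma HomD:
  assumes "f \<in> Hom C x y"
  shows "f \<in> Arr C" "source C f = x" "target C f = y"
  using assms by (auto simp: Hom_def)

lemma Arr_Hom: "f \<in> Arr C \<Longrightarrow> f \<in> Hom C (source C f) (target C f)"
  by (simp add: Hom_def)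

context category
begin

text \<open>The axioms \<open>cmp_closed\<close>, \<open>ident_left\<close> and
  \<open>cmp_assoc\<close> have premises about objects that their conclusions do not mention.
  Phrased through \<open>source\<close> and \<open>target\<close>, these laws become conditional
  rewrite rules whose side conditions are computed from the arrows themselves.\<close>

lemma cmp_arr:
  assumes "f \<in> Arr C" "g \<in> Arr C" "target C f = source C g"
  shows "g \<cdot> f \<in> Arr C" "source C (g \<cdot> f) = source C f" "target C (g \<cdot> f) = target C g"
  using cmp_closed[of f "source C f" "target C f" g "target C g"] assms by (auto simp: Hom_def)

lemma ident_arr:
  assumes "x \<in> Obj C"
  shows "ident C x \<in> Arr C" "source C (ident C x) = x" "target C (ident C x) = x"
  using ident_closed[OF assms] by (auto simp: Hom_def)

lemma cmp_ident_left: "\<lbrakk>f \<in> Arr C; target C f = y\<rbrakk> \<Longrightarrow> ident C y \<cdot> f = f"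
  by (rule ident_left) (auto simp: Hom_def)

lemma cmp_ident_right: "\<lbrakk>f \<in> Arr C; source C f = x\<rbrakk> \<Longrightarrow> f \<cdot> ident C x = f"
  by (rule ident_right) (auto simp: Hom_def)

lemma cmp_assoc_arr:
  "\<lbrakk>f \<in> Arr C; g \<in> Arr C; h \<in> Arr C; target C f = source C g; target C g = source C h\<rbrakk>
    \<Longrightarrow> (h \<cdot> g) \<cdot> f = h \<cdot> (g \<cdot> f)"
  by (rule cmp_assoc[OF Arr_Hom]) (auto simp: Hom_def)

lemmas arr_simps = source_closed target_closed cmp_arr ident_arr cmp_ident_left cmp_ident_right
  cmp_assoc_arr

text \<open>\<open>inverse_arr\<close> is a definite description, so it meets its specification only
  because inverses are unique: for two inverses \<open>g\<close> and \<open>h\<close> of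
  \<open>f\<close>, associativity turns \<open>h \<cdot> (f \<cdot> g)\<close> into
  \<open>(h \<cdot> f) \<cdot> g\<close>, whence \<open>h = g\<close>.\<close>

lemma inverse_arr_pair:
  assumes "is_iso C f"
  shows "inverse_pair C f (inverse_arr C f)"
proof -
  obtain g where g: "inverse_pair C f g"
    using assms by (auto simp: is_iso_def)
  have "h = g" if h: "inverse_pair C f h" for h
  proof -
    have "h = h \<cdot> (f \<cdot> g)"
      using g h by (simp add: inverse_pair_def Hom_def arr_simps)
    also have "\<dots> = (h \<cdot> f) \<cdot> g"
      by (rule cmp_assoc_arr[symmetric]) (use g h in \<open>simp_all add: inverse_pair_def Hom_def\<close>)
    also have "\<dots> = g"
      using g h by (simp add: inverse_pair_def Hom_def cmp_ident_left)
    finally show ?thesis .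
  qed
  then show ?thesis
    unfolding inverse_arr_def by (rule theI[where P = "inverse_pair C f", OF g])
qed

lemma inverse_arr:
  assumes "is_iso C f"
  shows "f \<in> Arr C" "inverse_arr C f \<in> Arr C"
    "source C (inverse_arr C f) = target C f" "target C (inverse_arr C f) = source C f"
    "inverse_arr C f \<cdot> f = ident C (source C f)" "f \<cdot> inverse_arr C f = ident C (target C f)"
  using inverse_arr_pair[OF assms] by (auto simp: inverse_pair_def Hom_def)

lemma iso_cancel_right:
  assumes iso: "is_iso C f" and g: "g \<in> Hom C (target C f) y" and h: "h \<in> Hom C (target C f) y"
    and eq: "g \<cdot> f = h \<cdot> f"
  shows "g = h"
proof -
  have "g = (g \<cdot> f) \<cdot> inverse_arr C f"
    using g by (simp add: arr_simps inverse_arr[OF iso] HomD[OF g])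
  also have "\<dots> = (h \<cdot> f) \<cdot> inverse_arr C f"
    by (simp only: eq)
  also have "\<dots> = h"
    using h by (simp add: arr_simps inverse_arr[OF iso] HomD[OF h])
  finally show ?thesis .
qed

end

section \<open>Functors, and faithfulness of equivalences\<close>

lemma is_functor_arr:
  assumes F: "is_functor C D F" and f: "f \<in> Arr C"
  shows "ar F f \<in> Arr D" "source D (ar F f) = ob F (source C f)"
    "target D (ar F f) = ob F (target C f)"
proof -
  interpret category C
    using F by (simp add: is_functor_def)
  have "ar F f \<in> Hom D (ob F (source C f)) (ob F (target C f))"
    using F f Arr_Hom[OF f] source_closed[OF f] target_closed[OF f] unfolding is_functor_def by blast
  then show "ar F f \<in> Arr D" "source D (ar F f) = ob F (source C f)"
    "target D (ar F f) = ob F (target C f)"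
    by (auto simp: Hom_def)
qed

lemma is_functor_ob: "\<lbrakk>is_functor C D F; x \<in> Obj C\<rbrakk> \<Longrightarrow> ob F x \<in> Obj D"
  by (simp add: is_functor_def)

lemma is_functor_ident: "\<lbrakk>is_functor C D F; x \<in> Obj C\<rbrakk> \<Longrightarrow> ar F (ident C x) = ident D (ob F x)"
  by (simp add: is_functor_def)

lemma is_functor_cmp:
  assumes F: "is_functor C D F"
    and fg: "f \<in> Arr C" "g \<in> Arr C" "target C f = source C g"
  shows "ar F (g \<cdot>\<^bsub>C\<^esub> f) = ar F g \<cdot>\<^bsub>D\<^esub> ar F f"
proof -
  interpret category C
    using F by (simp add: is_functor_def)
  have "f \<in> Hom C (source C f) (source C g)" "g \<in> Hom C (source C g) (target C g)"
    using fg by (auto simp: Hom_def)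
  then show ?thesis
    using F fg source_closed target_closed unfolding is_functor_def by metis
qed

lemmas functor_simps = is_functor_arr is_functor_ob is_functor_ident is_functor_cmp

text \<open>Naturality of \<open>\<alpha>\<close> together with invertibility of its component at
  \<open>y\<close> recovers an arrow from its image: \<open>f\<close> is the composite of
  \<open>\<alpha> x\<close>, \<open>ar G (ar F f)\<close> and the inverse of
  \<open>\<alpha> y\<close>.\<close>

lemma equivalence_faithful:
  fixes C :: "('o1, 'm1, 'z1) cat_scheme" and D :: "('o2, 'm2, 'z2) cat_scheme"
  assumes eqv: "is_equivalence C D F"
    and f: "f \<in> Hom C x y" and g: "g \<in> Hom C x y" and eq: "ar F f = ar F g"
  shows "f = g"
proof -
  obtain G :: "('o2, 'm2, 'o1, 'm1) func" and \<alpha> where FF: "is_functor C D F" and G: "is_functor D C G"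
    and \<alpha>: "natural_isomorphism C C id_func (comp_func G F) \<alpha>"
    using eqv by (auto simp: is_equivalence_def)
  interpret category C
    using FF by (simp add: is_functor_def)
  have x: "x \<in> Obj C" and y: "y \<in> Obj C"
    using f source_closed target_closed by (auto simp: Hom_def)
  have nat: "\<alpha> y \<cdot>\<^bsub>C\<^esub> h = ar G (ar F h) \<cdot>\<^bsub>C\<^esub> \<alpha> x" if "h \<in> Hom C x y" for h
    using \<alpha> x y that by (simp add: natural_isomorphism_def natural_transformation_def id_func_def
        comp_func_def)
  have iso: "is_iso C (\<alpha> y)" and \<alpha>y: "\<alpha> y \<in> Hom C y (ob G (ob F y))"
    using \<alpha> y by (simp_all add: natural_isomorphism_def natural_transformation_def id_func_def
        comp_func_def)
  have "h = inverse_arr C (\<alpha> y) \<cdot>\<^bsub>C\<^esub> (ar G (ar F h) \<cdot>\<^bsub>C\<^esub> \<alpha> x)" if h: "h \<in> Hom C x y" for h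
  proof -
    have "h = (inverse_arr C (\<alpha> y) \<cdot>\<^bsub>C\<^esub> \<alpha> y) \<cdot>\<^bsub>C\<^esub> h"
      by (simp add: inverse_arr[OF iso] HomD[OF \<alpha>y] HomD[OF h] arr_simps)
    also have "\<dots> = inverse_arr C (\<alpha> y) \<cdot>\<^bsub>C\<^esub> (\<alpha> y \<cdot>\<^bsub>C\<^esub> h)"
      by (rule cmp_assoc_arr) (simp_all add: inverse_arr[OF iso] HomD[OF \<alpha>y] HomD[OF h])
    finally show ?thesis
      by (simp only: nat[OF h])
  qed
  from this[OF f] this[OF g] show ?thesis
    by (simp add: eq)
qed

text \<open>The comparison functor sends an arrow to the triple of its source module, its image
  under \<open>R\<close> and its target module. Parallel arrows that agree under \<open>R\<close>
  therefore have the same image, and an equivalence is faithful.\<close>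

lemma monadic_faithful:
  assumes "monadic C D T R" and "f \<in> Hom D v w" "g \<in> Hom D v w" and "ar R f = ar R g"
  shows "f = g"
  using assms
  by (intro equivalence_faithful[of D _ "comparison_functor C D T R" f v w g])
    (auto simp: monadic_def comparison_functor_def Hom_def Let_def)

section \<open>The interchange law in a monoidal category\<close>

context monoidal_category
begin

lemma tens_arr:
  assumes "f \<in> Arr C" "g \<in> Arr C"
  shows "f \<bullet> g \<in> Arr C" "source C (f \<bullet> g) = source C f \<star> source C g"
    "target C (f \<bullet> g) = target C f \<star> target C g"
  using tens_ar_closed[OF Arr_Hom[OF assms(1)] Arr_Hom[OF assms(2)]] by (auto simp: Hom_def)

lemma tens_interchange:
  assumes "f \<in> Arr C" "f' \<in> Arr C" "g \<in> Arr C" "g' \<in> Arr C"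
    "target C f = source C f'" "target C g = source C g'"
  shows "f' \<bullet> g' \<cdot> f \<bullet> g = (f' \<cdot> f) \<bullet> (g' \<cdot> g)"
  by (rule tens_cmp[OF Arr_Hom _ Arr_Hom, symmetric]) (use assms in \<open>auto simp: Hom_def\<close>)

text \<open>\<open>cmp_assoc_arr\<close> brackets composites to the right, so two adjacent tensor
  products of arrows usually carry a further factor \<open>h\<close>. The interchange law has to
  apply in that shape as well.\<close>

lemma tens_interchange_assoc:
  assumes "f \<in> Arr C" "f' \<in> Arr C" "g \<in> Arr C" "g' \<in> Arr C" "h \<in> Arr C"
    "target C f = source C f'" "target C g = source C g'" "target C h = source C f \<star> source C g"
  shows "f' \<bullet> g' \<cdot> (f \<bullet> g \<cdot> h) = (f' \<cdot> f) \<bullet> (g' \<cdot> g) \<cdot> h"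
proof -
  have "f' \<bullet> g' \<cdot> (f \<bullet> g \<cdot> h) = (f' \<bullet> g' \<cdot> f \<bullet> g) \<cdot> h"
    by (rule cmp_assoc_arr[symmetric]) (use assms in \<open>simp_all add: tens_arr\<close>)
  then show ?thesis
    using assms by (simp add: tens_interchange)
qed

lemmas tens_simps = arr_simps tens_ob_closed unit_ob_closed tens_arr tens_ident tens_interchange
  tens_interchange_assoc

end

section \<open>A strong monoidal functor with a right adjoint: unit, counit and transposes\<close>

locale monoidal_adjunction =
  C: monoidal_category C + D: monoidal_category D
  for C :: "('oc, 'mc, 'k, 'z1) moncat_scheme" and D :: "('od, 'md, 'k, 'z2) moncat_scheme" +
  fixes T :: "('oc, 'mc, 'od, 'md) monfunc" and R :: "('oc, 'mc, 'od, 'md) radj"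
  assumes monoidal: "monoidal_functor C D T"
    and adjoint: "is_right_adjoint C D T R"
begin

lemma functors: "is_functor C D T" "is_functor D C R"
  using adjoint by (auto simp: is_right_adjoint_def)

lemma counit_arr:
  assumes "v \<in> Obj D"
  shows "adj_counit R v \<in> Arr D" "source D (adj_counit R v) = ob T (ob R v)"
    "target D (adj_counit R v) = v"
  using adjoint assms
  by (auto simp: is_right_adjoint_def natural_transformation_def id_func_def comp_func_def Hom_def)

lemma unit_arr:
  assumes "x \<in> Obj C"
  shows "adj_unit R x \<in> Arr C" "source C (adj_unit R x) = x"
    "target C (adj_unit R x) = ob R (ob T x)"
  using adjoint assms
  by (auto simp: is_right_adjoint_def natural_transformation_def id_func_def comp_func_def Hom_def)

lemma fmult_iso: "\<lbrakk>x \<in> Obj C; y \<in> Obj C\<rbrakk> \<Longrightarrow> is_iso D (fmult T x y)"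
  using monoidal by (simp add: monoidal_functor_def)

lemma fmult_arr:
  assumes "x \<in> Obj C" "y \<in> Obj C"
  shows "fmult T x y \<in> Arr D" "source D (fmult T x y) = ob T x \<star>\<^bsub>D\<^esub> ob T y"
    "target D (fmult T x y) = ob T (x \<star>\<^bsub>C\<^esub> y)"
  using monoidal assms by (auto simp: monoidal_functor_def Hom_def)

lemma fmult_natural:
  assumes f: "f \<in> Arr C" and g: "g \<in> Arr C"
  shows "ar T (f \<bullet>\<^bsub>C\<^esub> g) \<cdot>\<^bsub>D\<^esub> fmult T (source C f) (source C g) =
    fmult T (target C f) (target C g) \<cdot>\<^bsub>D\<^esub> ar T f \<bullet>\<^bsub>D\<^esub> ar T g"
  using monoidal Arr_Hom[OF f] Arr_Hom[OF g] f g C.source_closed C.target_closed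
  unfolding monoidal_functor_def by metis

lemmas adj_simps = functor_simps[OF functors(1)] functor_simps[OF functors(2)] counit_arr unit_arr
  fmult_arr C.tens_simps D.tens_simps

lemma counit_natural:
  assumes f: "f \<in> Arr D"
  shows "adj_counit R (target D f) \<cdot>\<^bsub>D\<^esub> ar T (ar R f) = f \<cdot>\<^bsub>D\<^esub> adj_counit R (source D f)"
  using adjoint f Arr_Hom[OF f] D.source_closed[OF f] D.target_closed[OF f]
  unfolding is_right_adjoint_def natural_transformation_def id_func_def comp_func_def by simp

lemma unit_natural:
  assumes f: "f \<in> Arr C"
  shows "adj_unit R (target C f) \<cdot>\<^bsub>C\<^esub> f = ar R (ar T f) \<cdot>\<^bsub>C\<^esub> adj_unit R (source C f)"
  using adjoint f Arr_Hom[OF f] C.source_closed[OF f] C.target_closed[OF f]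
  unfolding is_right_adjoint_def natural_transformation_def id_func_def comp_func_def by simp

lemma triangle_T:
  "x \<in> Obj C \<Longrightarrow> adj_counit R (ob T x) \<cdot>\<^bsub>D\<^esub> ar T (adj_unit R x) = ident D (ob T x)"
  using adjoint by (simp add: is_right_adjoint_def)

lemma triangle_R:
  "v \<in> Obj D \<Longrightarrow> ar R (adj_counit R v) \<cdot>\<^bsub>C\<^esub> adj_unit R (ob R v) = ident C (ob R v)"
  using adjoint by (simp add: is_right_adjoint_def)

text \<open>One half of the adjunction bijection. Naturality of the counit moves \<open>h\<close> to
  the outside, and the triangle identity at \<open>ob T x\<close> removes what remains.\<close>

lemma counit_transpose:
  assumes x: "x \<in> Obj C" and h: "h \<in> Hom D (ob T x) v"
  shows "adj_counit R v \<cdot>\<^bsub>D\<^esub> ar T (ar R h \<cdot>\<^bsub>C\<^esub> adj_unit R x) = h"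
proof -
  note h' = HomD[OF h]
  have v: "v \<in> Obj D"
    using D.target_closed[OF h'(1)] by (simp add: h')
  have "adj_counit R v \<cdot>\<^bsub>D\<^esub> ar T (ar R h \<cdot>\<^bsub>C\<^esub> adj_unit R x) =
      (adj_counit R v \<cdot>\<^bsub>D\<^esub> ar T (ar R h)) \<cdot>\<^bsub>D\<^esub> ar T (adj_unit R x)"
    using x v by (simp add: adj_simps h')
  also have "\<dots> = h \<cdot>\<^bsub>D\<^esub> (adj_counit R (ob T x) \<cdot>\<^bsub>D\<^esub> ar T (adj_unit R x))"
    using x v counit_natural[OF h'(1)] by (simp add: adj_simps h')
  also have "\<dots> = h"
    using x by (simp add: triangle_T adj_simps h')
  finally show ?thesis .
qed

text \<open>The other half of the bijection: by naturality of the unit and the triangle identity at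
  \<open>ob R v\<close>, an arrow into \<open>ob R v\<close> is rebuilt from its transpose.
  Equations between such arrows can thus be checked in \<open>D\<close>.\<close>

lemma transpose_inject:
  assumes g: "g \<in> Hom C x (ob R v)" and h: "h \<in> Hom C x (ob R v)" and v: "v \<in> Obj D"
    and eq: "adj_counit R v \<cdot>\<^bsub>D\<^esub> ar T g = adj_counit R v \<cdot>\<^bsub>D\<^esub> ar T h"
  shows "g = h"
proof -
  have "f = ar R (adj_counit R v \<cdot>\<^bsub>D\<^esub> ar T f) \<cdot>\<^bsub>C\<^esub> adj_unit R x"
    if f: "f \<in> Hom C x (ob R v)" for f
  proof -
    note f' = HomD[OF f]
    have x: "x \<in> Obj C"
      using C.source_closed[OF f'(1)] by (simp add: f')
    have "ar R (adj_counit R v \<cdot>\<^bsub>D\<^esub> ar T f) \<cdot>\<^bsub>C\<^esub> adj_unit R x =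
        ar R (adj_counit R v) \<cdot>\<^bsub>C\<^esub> (adj_unit R (ob R v) \<cdot>\<^bsub>C\<^esub> f)"
      using x v unit_natural[OF f'(1)] by (simp add: adj_simps f')
    also have "\<dots> = (ar R (adj_counit R v) \<cdot>\<^bsub>C\<^esub> adj_unit R (ob R v)) \<cdot>\<^bsub>C\<^esub> f"
      using x v by (simp add: adj_simps f')
    also have "\<dots> = f"
      using v by (simp add: triangle_R adj_simps f')
    finally show ?thesis ..
  qed
  from this[OF g] this[OF h] show ?thesis
    by (simp add: eq)
qed

section \<open>The lax monoidal structure of \<open>R\<close>, and cancellation of the
  counit\<close>

lemma lax_mult_arr:
  assumes "v \<in> Obj D" "w \<in> Obj D"
  shows "lax_mult C D T R v w \<in> Arr C"
    "source C (lax_mult C D T R v w) = ob R v \<star>\<^bsub>C\<^esub> ob R w"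
    "target C (lax_mult C D T R v w) = ob R (v \<star>\<^bsub>D\<^esub> w)"
  using assms D.inverse_arr[OF fmult_iso[of "ob R v" "ob R w"]]
  by (auto simp: lax_mult_def adj_simps)

text \<open>\<open>lax_mult\<close> is the transpose of
  \<open>\<epsilon> \<otimes> \<epsilon>\<close> after the inverse of \<open>fmult\<close>.
  Precomposing with \<open>fmult\<close> removes this inverse, so later computations never meet
  it.\<close>

lemma lax_mult_transpose:
  assumes v: "v \<in> Obj D" and w: "w \<in> Obj D"
  shows "adj_counit R (v \<star>\<^bsub>D\<^esub> w) \<cdot>\<^bsub>D\<^esub> (ar T (lax_mult C D T R v w) \<cdot>\<^bsub>D\<^esub> fmult T (ob R v) (ob R w)) =
    adj_counit R v \<bullet>\<^bsub>D\<^esub> adj_counit R w"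
proof -
  have iso: "is_iso D (fmult T (ob R v) (ob R w))"
    using v w by (simp add: fmult_iso adj_simps)
  let ?h = "adj_counit R v \<bullet>\<^bsub>D\<^esub> adj_counit R w \<cdot>\<^bsub>D\<^esub> inverse_arr D (fmult T (ob R v) (ob R w))"
  have "adj_counit R (v \<star>\<^bsub>D\<^esub> w) \<cdot>\<^bsub>D\<^esub> ar T (lax_mult C D T R v w) = ?h"
    unfolding lax_mult_def
    by (rule counit_transpose)
      (use v w in \<open>simp_all add: Hom_def adj_simps D.inverse_arr[OF iso]\<close>)
  then have "adj_counit R (v \<star>\<^bsub>D\<^esub> w) \<cdot>\<^bsub>D\<^esub> (ar T (lax_mult C D T R v w) \<cdot>\<^bsub>D\<^esub> fmult T (ob R v) (ob R w)) =
      ?h \<cdot>\<^bsub>D\<^esub> fmult T (ob R v) (ob R w)"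
    using v w by (simp add: adj_simps lax_mult_arr flip: D.cmp_assoc_arr)
  also have "\<dots> = adj_counit R v \<bullet>\<^bsub>D\<^esub> adj_counit R w"
    using v w by (simp add: adj_simps D.inverse_arr[OF iso])
  finally show ?thesis .
qed

text \<open>Up to \<open>fmult\<close>, transposition carries lax products to tensor products:
  naturality of \<open>fmult\<close> splits \<open>T (f \<otimes> g)\<close> into
  \<open>T f \<otimes> T g\<close>, which is then absorbed into the two counits.\<close>

lemma lax_mult_transpose_tens:
  assumes f: "f \<in> Hom C x (ob R v)" and g: "g \<in> Hom C y (ob R w)"
    and v: "v \<in> Obj D" and w: "w \<in> Obj D"
  shows "adj_counit R (v \<star>\<^bsub>D\<^esub> w) \<cdot>\<^bsub>D\<^esub>
      (ar T (lax_mult C D T R v w \<cdot>\<^bsub>C\<^esub> f \<bullet>\<^bsub>C\<^esub> g) \<cdot>\<^bsub>D\<^esub> fmult T x y) =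
    (adj_counit R v \<cdot>\<^bsub>D\<^esub> ar T f) \<bullet>\<^bsub>D\<^esub> (adj_counit R w \<cdot>\<^bsub>D\<^esub> ar T g)"
proof -
  note f' = HomD[OF f] and g' = HomD[OF g]
  have x: "x \<in> Obj C" and y: "y \<in> Obj C"
    using C.source_closed[OF f'(1)] C.source_closed[OF g'(1)] by (simp_all add: f' g')
  let ?L = "lax_mult C D T R v w"
  have "ar T (?L \<cdot>\<^bsub>C\<^esub> f \<bullet>\<^bsub>C\<^esub> g) \<cdot>\<^bsub>D\<^esub> fmult T x y =
      ar T ?L \<cdot>\<^bsub>D\<^esub> (ar T (f \<bullet>\<^bsub>C\<^esub> g) \<cdot>\<^bsub>D\<^esub> fmult T x y)"
    using v w x y by (simp add: adj_simps f' g' lax_mult_arr)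
  also have "ar T (f \<bullet>\<^bsub>C\<^esub> g) \<cdot>\<^bsub>D\<^esub> fmult T x y =
      fmult T (ob R v) (ob R w) \<cdot>\<^bsub>D\<^esub> ar T f \<bullet>\<^bsub>D\<^esub> ar T g"
    using fmult_natural[OF f'(1) g'(1)] by (simp add: f' g')
  finally have "adj_counit R (v \<star>\<^bsub>D\<^esub> w) \<cdot>\<^bsub>D\<^esub> (ar T (?L \<cdot>\<^bsub>C\<^esub> f \<bullet>\<^bsub>C\<^esub> g) \<cdot>\<^bsub>D\<^esub> fmult T x y) =
      (adj_counit R (v \<star>\<^bsub>D\<^esub> w) \<cdot>\<^bsub>D\<^esub> (ar T ?L \<cdot>\<^bsub>D\<^esub> fmult T (ob R v) (ob R w))) \<cdot>\<^bsub>D\<^esub> ar T f \<bullet>\<^bsub>D\<^esub> ar T g"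
    using v w x y by (simp add: adj_simps f' g' lax_mult_arr)
  then show ?thesis
    using v w by (simp add: lax_mult_transpose adj_simps f' g')
qed

text \<open>Both sides are compared through their transposes, precomposed with \<open>fmult\<close>.
  There the claim becomes naturality of the counit in each tensor factor.\<close>

lemma lax_mult_natural:
  assumes f: "f \<in> Hom D v v'" and g: "g \<in> Hom D w w'"
  shows "ar R (f \<bullet>\<^bsub>D\<^esub> g) \<cdot>\<^bsub>C\<^esub> lax_mult C D T R v w =
    lax_mult C D T R v' w' \<cdot>\<^bsub>C\<^esub> ar R f \<bullet>\<^bsub>C\<^esub> ar R g"
proof -
  note f' = HomD[OF f] and g' = HomD[OF g]
  have obs: "v \<in> Obj D" "v' \<in> Obj D" "w \<in> Obj D" "w' \<in> Obj D"
    using D.source_closed[OF f'(1)] D.source_closed[OF g'(1)]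
      D.target_closed[OF f'(1)] D.target_closed[OF g'(1)] by (simp_all add: f' g')
  let ?F = "fmult T (ob R v) (ob R w)"
  let ?l = "ar R (f \<bullet>\<^bsub>D\<^esub> g) \<cdot>\<^bsub>C\<^esub> lax_mult C D T R v w"
  let ?r = "lax_mult C D T R v' w' \<cdot>\<^bsub>C\<^esub> ar R f \<bullet>\<^bsub>C\<^esub> ar R g"
  let ?e = "adj_counit R (v' \<star>\<^bsub>D\<^esub> w')"
  have fg: "f \<bullet>\<^bsub>D\<^esub> g \<in> Arr D"
    by (simp add: adj_simps f' g')
  have "?e \<cdot>\<^bsub>D\<^esub> (ar T ?l \<cdot>\<^bsub>D\<^esub> ?F) =
      (?e \<cdot>\<^bsub>D\<^esub> ar T (ar R (f \<bullet>\<^bsub>D\<^esub> g))) \<cdot>\<^bsub>D\<^esub> (ar T (lax_mult C D T R v w) \<cdot>\<^bsub>D\<^esub> ?F)"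
    using obs by (simp add: adj_simps f' g' lax_mult_arr)
  also have "?e \<cdot>\<^bsub>D\<^esub> ar T (ar R (f \<bullet>\<^bsub>D\<^esub> g)) = f \<bullet>\<^bsub>D\<^esub> g \<cdot>\<^bsub>D\<^esub> adj_counit R (v \<star>\<^bsub>D\<^esub> w)"
    using counit_natural[OF fg] by (simp add: adj_simps f' g')
  also have "\<dots> \<cdot>\<^bsub>D\<^esub> (ar T (lax_mult C D T R v w) \<cdot>\<^bsub>D\<^esub> ?F) =
      f \<bullet>\<^bsub>D\<^esub> g \<cdot>\<^bsub>D\<^esub> (adj_counit R (v \<star>\<^bsub>D\<^esub> w) \<cdot>\<^bsub>D\<^esub> (ar T (lax_mult C D T R v w) \<cdot>\<^bsub>D\<^esub> ?F))"
    using obs by (simp add: adj_simps f' g' lax_mult_arr)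
  also have "\<dots> = (f \<cdot>\<^bsub>D\<^esub> adj_counit R v) \<bullet>\<^bsub>D\<^esub> (g \<cdot>\<^bsub>D\<^esub> adj_counit R w)"
    using obs by (simp add: lax_mult_transpose adj_simps f' g')
  also have "\<dots> = (adj_counit R v' \<cdot>\<^bsub>D\<^esub> ar T (ar R f)) \<bullet>\<^bsub>D\<^esub> (adj_counit R w' \<cdot>\<^bsub>D\<^esub> ar T (ar R g))"
    using counit_natural[OF f'(1)] counit_natural[OF g'(1)] by (simp add: f' g')
  also have "\<dots> = ?e \<cdot>\<^bsub>D\<^esub> (ar T ?r \<cdot>\<^bsub>D\<^esub> ?F)"
    by (rule lax_mult_transpose_tens[symmetric])
      (use obs in \<open>simp_all add: Hom_def adj_simps f' g'\<close>)
  \<comment> \<open>The two operations are now undone in turn: \<open>?F\<close> is an isomorphism,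
    and transposition is injective.\<close>
  finally have "(?e \<cdot>\<^bsub>D\<^esub> ar T ?l) \<cdot>\<^bsub>D\<^esub> ?F = (?e \<cdot>\<^bsub>D\<^esub> ar T ?r) \<cdot>\<^bsub>D\<^esub> ?F"
    using obs by (simp add: adj_simps f' g' lax_mult_arr)
  then have "?e \<cdot>\<^bsub>D\<^esub> ar T ?l = ?e \<cdot>\<^bsub>D\<^esub> ar T ?r"
    by (rule D.iso_cancel_right[OF fmult_iso, rotated -1])
      (use obs in \<open>simp_all add: Hom_def adj_simps f' g' lax_mult_arr\<close>)
  then show ?thesis
    by (rule transpose_inject[rotated -1])
      (use obs in \<open>simp_all add: Hom_def adj_simps f' g' lax_mult_arr\<close>)
qed

text \<open>The splitting is used in factored form. The projection map at \<open>v\<close> is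
  invertible and factors through \<open>R (id \<otimes> \<epsilon>)\<close>, so \<open>R f\<close>
  and \<open>R g\<close> agree once they agree after \<open>R (id \<otimes> \<epsilon>)\<close>;
  faithfulness of \<open>R\<close> then gives \<open>f = g\<close>.\<close>

lemma tens_counit_epi:
  assumes proj: "projection_formula C D T R" and mon: "monadic C D T R"
    and x: "x \<in> Obj C" and v: "v \<in> Obj D"
    and f: "f \<in> Hom D (ob T x \<star>\<^bsub>D\<^esub> v) w" and g: "g \<in> Hom D (ob T x \<star>\<^bsub>D\<^esub> v) w"
    and eq: "f \<cdot>\<^bsub>D\<^esub> ident D (ob T x) \<bullet>\<^bsub>D\<^esub> adj_counit R v =
      g \<cdot>\<^bsub>D\<^esub> ident D (ob T x) \<bullet>\<^bsub>D\<^esub> adj_counit R v"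
  shows "f = g"
proof -
  note f' = HomD[OF f] and g' = HomD[OF g]
  let ?e = "ident D (ob T x) \<bullet>\<^bsub>D\<^esub> adj_counit R v"
  let ?v' = "ob T (ob R v)"
  \<comment> \<open>\<open>?s\<close> is the projection map at \<open>?v'\<close> precomposed with
    \<open>id \<otimes> \<eta>\<close>, where \<open>\<eta>\<close> is the unit at
    \<open>ob R v\<close>, the section of \<open>R \<epsilon>\<close>.\<close>
  let ?s = "lax_mult C D T R (ob T x) ?v' \<cdot>\<^bsub>C\<^esub> adj_unit R x \<bullet>\<^bsub>C\<^esub> adj_unit R (ob R v)"
  have Re: "ar R ?e \<cdot>\<^bsub>C\<^esub> lax_mult C D T R (ob T x) ?v' =
      lax_mult C D T R (ob T x) v \<cdot>\<^bsub>C\<^esub> ident C (ob R (ob T x)) \<bullet>\<^bsub>C\<^esub> ar R (adj_counit R v)"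
    using lax_mult_natural[of "ident D (ob T x)" "ob T x" "ob T x" "adj_counit R v" ?v' v] x v
    by (simp add: Hom_def adj_simps)
  have "ar R ?e \<cdot>\<^bsub>C\<^esub> ?s = (ar R ?e \<cdot>\<^bsub>C\<^esub> lax_mult C D T R (ob T x) ?v') \<cdot>\<^bsub>C\<^esub>
      adj_unit R x \<bullet>\<^bsub>C\<^esub> adj_unit R (ob R v)"
    using x v by (simp add: adj_simps lax_mult_arr)
  \<comment> \<open>After \<open>Re\<close> has moved \<open>R \<epsilon>\<close> to the right of
    \<open>lax_mult\<close>, it meets the unit at \<open>ob R v\<close>, and the triangle identity
    cancels the two.\<close>
  also have "\<dots> = projection_map C D T R x v"
    using x v unfolding Re projection_map_def by (simp add: adj_simps lax_mult_arr triangle_R)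
  finally have s: "projection_map C D T R x v = ar R ?e \<cdot>\<^bsub>C\<^esub> ?s" ..
  have Rcmp: "ar R h \<cdot>\<^bsub>C\<^esub> projection_map C D T R x v = ar R (h \<cdot>\<^bsub>D\<^esub> ?e) \<cdot>\<^bsub>C\<^esub> ?s"
    if "h \<in> Hom D (ob T x \<star>\<^bsub>D\<^esub> v) w" for h
    using x v HomD[OF that] unfolding s by (simp add: adj_simps lax_mult_arr)
  have "ar R f \<cdot>\<^bsub>C\<^esub> projection_map C D T R x v = ar R g \<cdot>\<^bsub>C\<^esub> projection_map C D T R x v"
    by (simp only: Rcmp[OF f] Rcmp[OF g] eq)
  moreover have "is_iso C (projection_map C D T R x v)"
    using proj x v by (simp add: projection_formula_def)
  ultimately have "ar R f = ar R g"
    by (intro C.iso_cancel_right[of "projection_map C D T R x v" "ar R f" "ob R w" "ar R g"])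
      (use x v in \<open>simp_all add: projection_map_def Hom_def adj_simps lax_mult_arr f' g'\<close>)
  with mon f g show ?thesis
    by (rule monadic_faithful)
qed

text \<open>Read \<open>f\<close> and \<open>g\<close> as generalised elements of the algebra on
  \<open>ob R (alg_ob A)\<close>: up to \<open>fmult\<close>, the transpose of their product is the
  product in \<open>A\<close> of their transposes. Naturality of the counit at the multiplication of
  \<open>A\<close> reduces this to the lax structure.\<close>

lemma radj_algebra_transpose:
  assumes A: "is_algebra D A"
    and f: "f \<in> Hom C x (ob R (alg_ob A))" and g: "g \<in> Hom C y (ob R (alg_ob A))"
  shows "adj_counit R (alg_ob A) \<cdot>\<^bsub>D\<^esub>
      (ar T (alg_mult (radj_algebra C D T R A) \<cdot>\<^bsub>C\<^esub> f \<bullet>\<^bsub>C\<^esub> g) \<cdot>\<^bsub>D\<^esub> fmult T x y) =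
    alg_mult A \<cdot>\<^bsub>D\<^esub>
      (adj_counit R (alg_ob A) \<cdot>\<^bsub>D\<^esub> ar T f) \<bullet>\<^bsub>D\<^esub> (adj_counit R (alg_ob A) \<cdot>\<^bsub>D\<^esub> ar T g)"
proof -
  note f' = HomD[OF f] and g' = HomD[OF g]
  let ?a = "alg_ob A" and ?m = "alg_mult A"
  let ?L = "lax_mult C D T R ?a ?a"
  have a: "?a \<in> Obj D" and m: "?m \<in> Hom D (?a \<star>\<^bsub>D\<^esub> ?a) ?a"
    using A by (auto simp: is_algebra_def)
  note m' = HomD[OF m]
  have xy: "x \<in> Obj C" "y \<in> Obj C"
    using C.source_closed[OF f'(1)] C.source_closed[OF g'(1)] by (simp_all add: f' g')
  have "adj_counit R ?a \<cdot>\<^bsub>D\<^esub> (ar T (alg_mult (radj_algebra C D T R A) \<cdot>\<^bsub>C\<^esub> f \<bullet>\<^bsub>C\<^esub> g) \<cdot>\<^bsub>D\<^esub> fmult T x y) =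
      (adj_counit R ?a \<cdot>\<^bsub>D\<^esub> ar T (ar R ?m)) \<cdot>\<^bsub>D\<^esub> (ar T (?L \<cdot>\<^bsub>C\<^esub> f \<bullet>\<^bsub>C\<^esub> g) \<cdot>\<^bsub>D\<^esub> fmult T x y)"
    using a xy by (simp add: radj_algebra_def adj_simps lax_mult_arr f' g' m')
  also have "adj_counit R ?a \<cdot>\<^bsub>D\<^esub> ar T (ar R ?m) = ?m \<cdot>\<^bsub>D\<^esub> adj_counit R (?a \<star>\<^bsub>D\<^esub> ?a)"
    using counit_natural[OF m'(1)] by (simp add: m')
  also have "\<dots> \<cdot>\<^bsub>D\<^esub> (ar T (?L \<cdot>\<^bsub>C\<^esub> f \<bullet>\<^bsub>C\<^esub> g) \<cdot>\<^bsub>D\<^esub> fmult T x y) =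
      ?m \<cdot>\<^bsub>D\<^esub> (adj_counit R (?a \<star>\<^bsub>D\<^esub> ?a) \<cdot>\<^bsub>D\<^esub> (ar T (?L \<cdot>\<^bsub>C\<^esub> f \<bullet>\<^bsub>C\<^esub> g) \<cdot>\<^bsub>D\<^esub> fmult T x y))"
    using a xy by (simp add: adj_simps lax_mult_arr f' g' m')
  finally show ?thesis
    by (simp only: lax_mult_transpose_tens[OF f g a a])
qed

end

section \<open>Comparison of the moment map equation with the centrality equation\<close>

theorem proposition3p13:
  fixes \<kappa> :: "'u rel" and k :: "('k, 'w) ring_scheme"
    and C :: "('oc, 'mc, 'k) brcat" and D :: "('od, 'md, 'k) moncat"
    and T :: "('oc, 'mc, 'od, 'md) monfunc" and \<tau> :: "'oc \<Rightarrow> 'od \<Rightarrow> 'md"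
    and R :: "('oc, 'mc, 'od, 'md) radj"
    and A :: "('od, 'md) alg" and \<mu> :: 'md and \<mu>' :: 'mc
  assumes "inaccessible \<kappa>"
    and "quantum_manin_pair \<kappa> k C D T \<tau>"
    and "is_right_adjoint C D T R"
    and "projection_formula C D T R"
    and "monadic C D T R"
    and "is_algebra D A"
    and "algebra_map D (moment_algebra C D T R) A \<mu>"
    and "\<mu>' = adjoint_map C R (ob R \<I>\<^bsub>D\<^esub>) \<mu>"
  shows "quantum_moment_map C D T \<tau> R A \<mu> \<longleftrightarrow>
    is_central C (radj_algebra C D T R (unit_algebra D)) (radj_algebra C D T R A) \<mu>'"
proof -
  interpret Q: quantum_manin_pair \<kappa> k C D T \<tau>
    by (rule assms(2))
  interpret monoidal_adjunction C D T R
    by unfold_locales (rule Q.monoidal assms(3))+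
  let ?a = "alg_ob A" and ?m = "alg_mult A"
  let ?x = "ob R \<I>\<^bsub>D\<^esub>"
  let ?y = "ob R ?a"
  let ?e = "adj_counit R ?a" and ?F = "fmult T ?x ?y" and ?M = "alg_mult (radj_algebra C D T R A)"
  \<comment> \<open>\<open>?f\<close> and \<open>?g\<close> are the two sides of the moment map
    equation, \<open>?l\<close> and \<open>?r\<close> the two sides of the centrality
    equation.\<close>
  let ?f = "?m \<cdot>\<^bsub>D\<^esub> \<mu> \<bullet>\<^bsub>D\<^esub> ident D ?a"
  let ?g = "?m \<cdot>\<^bsub>D\<^esub> ident D ?a \<bullet>\<^bsub>D\<^esub> \<mu> \<cdot>\<^bsub>D\<^esub> \<tau> ?x ?a"
  let ?l = "?M \<cdot>\<^bsub>C\<^esub> \<mu>' \<bullet>\<^bsub>C\<^esub> ident C ?y"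
  let ?r = "?M \<cdot>\<^bsub>C\<^esub> ident C ?y \<bullet>\<^bsub>C\<^esub> \<mu>' \<cdot>\<^bsub>C\<^esub> braid C ?x ?y"
  have a: "?a \<in> Obj D" and m: "?m \<in> Hom D (?a \<star>\<^bsub>D\<^esub> ?a) ?a"
    using assms(6) by (auto simp: is_algebra_def)
  have x: "?x \<in> Obj C" and y: "?y \<in> Obj C"
    using a by (simp_all add: adj_simps)
  have \<mu>: "\<mu> \<in> Hom D (ob T ?x) ?a"
    using assms(7) by (simp add: algebra_map_def moment_algebra_def image_algebra_def
        radj_algebra_def unit_algebra_def)
  have \<mu>': "\<mu>' \<in> Hom C ?x ?y"
    using x HomD[OF \<mu>] by (simp add: assms(8) adjoint_map_def Hom_def adj_simps)
  have idy: "ident C ?y \<in> Hom C ?y ?y"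
    using y by (simp add: Hom_def adj_simps)
  have b: "braid C ?x ?y \<in> Hom C (?x \<star>\<^bsub>C\<^esub> ?y) (?y \<star>\<^bsub>C\<^esub> ?x)"
    using Q.braid_closed[OF x y] by simp
  have \<tau>: "\<tau> ?x v \<in> Hom D (ob T ?x \<star>\<^bsub>D\<^esub> v) (v \<star>\<^bsub>D\<^esub> ob T ?x)" if "v \<in> Obj D" for v
    using Q.half_braidings[OF x] that by (simp add: half_braiding_def)
  have Ty: "ob T ?y \<in> Obj D"
    using y by (simp add: adj_simps)
  have M: "?M \<in> Hom C (?y \<star>\<^bsub>C\<^esub> ?y) ?y"
    using a HomD[OF m] by (simp add: radj_algebra_def Hom_def adj_simps lax_mult_arr)
  note arrs = HomD[OF m] HomD[OF \<mu>] HomD[OF \<mu>'] HomD[OF b] HomD[OF \<tau>[OF a]] HomD[OF \<tau>[OF Ty]]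
    HomD[OF M]
  have e\<mu>': "?e \<cdot>\<^bsub>D\<^esub> ar T \<mu>' = \<mu>"
    unfolding assms(8) adjoint_map_def using x \<mu> by (rule counit_transpose)
  \<comment> \<open>\<open>\<tau>_braid\<close> concerns \<open>\<tau>\<close> at objects in the
    image of \<open>T\<close>, such as \<open>ob T ?y\<close>. Naturality along the counit passes
    from there to \<open>\<tau>\<close> at \<open>?a\<close>.\<close>
  have \<tau>_nat: "\<tau> ?x ?a \<cdot>\<^bsub>D\<^esub> ident D (ob T ?x) \<bullet>\<^bsub>D\<^esub> ?e = ?e \<bullet>\<^bsub>D\<^esub> ident D (ob T ?x) \<cdot>\<^bsub>D\<^esub> \<tau> ?x (ob T ?y)"
    using Q.half_braidings[OF x] a Ty Arr_Hom[OF counit_arr(1)[OF a]]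
    by (simp add: half_braiding_def counit_arr)
  \<comment> \<open>The transpose of \<open>\<mu>'\<close> is \<open>\<mu>\<close> and that of the
    identity is \<open>?e\<close>; the interchange law separates \<open>?e\<close> as a factor on
    the right.\<close>
  have l: "?e \<cdot>\<^bsub>D\<^esub> (ar T ?l \<cdot>\<^bsub>D\<^esub> ?F) = ?f \<cdot>\<^bsub>D\<^esub> ident D (ob T ?x) \<bullet>\<^bsub>D\<^esub> ?e"
    unfolding radj_algebra_transpose[OF assms(6) \<mu>' idy] e\<mu>'
    using a x y by (simp add: adj_simps arrs)
  have "?e \<cdot>\<^bsub>D\<^esub> (ar T ?r \<cdot>\<^bsub>D\<^esub> ?F) =
      ?e \<cdot>\<^bsub>D\<^esub> (ar T (?M \<cdot>\<^bsub>C\<^esub> ident C ?y \<bullet>\<^bsub>C\<^esub> \<mu>') \<cdot>\<^bsub>D\<^esub> (ar T (braid C ?x ?y) \<cdot>\<^bsub>D\<^esub> ?F))"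
    using a x y by (simp add: adj_simps arrs)
  \<comment> \<open>\<open>\<tau>_braid\<close> replaces the image of the braiding by
    \<open>\<tau>\<close>, at the same time exchanging the arguments of \<open>fmult\<close>, as the
    transposition formula for the swapped product requires.\<close>
  also have "\<dots> = (?e \<cdot>\<^bsub>D\<^esub> (ar T (?M \<cdot>\<^bsub>C\<^esub> ident C ?y \<bullet>\<^bsub>C\<^esub> \<mu>') \<cdot>\<^bsub>D\<^esub> fmult T ?y ?x)) \<cdot>\<^bsub>D\<^esub> \<tau> ?x (ob T ?y)"
    unfolding Q.\<tau>_braid[OF x y, symmetric] using a x y by (simp add: adj_simps arrs)
  also have "\<dots> = (?m \<cdot>\<^bsub>D\<^esub> ident D ?a \<bullet>\<^bsub>D\<^esub> \<mu>) \<cdot>\<^bsub>D\<^esub> (?e \<bullet>\<^bsub>D\<^esub> ident D (ob T ?x) \<cdot>\<^bsub>D\<^esub> \<tau> ?x (ob T ?y))"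
    unfolding radj_algebra_transpose[OF assms(6) idy \<mu>'] e\<mu>'
    using a x y by (simp add: adj_simps arrs)
  also have "\<dots> = ?g \<cdot>\<^bsub>D\<^esub> ident D (ob T ?x) \<bullet>\<^bsub>D\<^esub> ?e"
    unfolding \<tau>_nat[symmetric] using a x y by (simp add: adj_simps arrs)
  finally have r: "?e \<cdot>\<^bsub>D\<^esub> (ar T ?r \<cdot>\<^bsub>D\<^esub> ?F) = ?g \<cdot>\<^bsub>D\<^esub> ident D (ob T ?x) \<bullet>\<^bsub>D\<^esub> ?e" .
  \<comment> \<open>From left to right, \<open>?F\<close> and the transposition are cancelled. From
    right to left, \<open>id \<otimes> \<epsilon>\<close> is cancelled, which is where the
    projection formula and monadicity enter.\<close>
  have "?f = ?g \<longleftrightarrow> ?l = ?r"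
  proof
    assume "?f = ?g"
    then have "?e \<cdot>\<^bsub>D\<^esub> (ar T ?l \<cdot>\<^bsub>D\<^esub> ?F) = ?e \<cdot>\<^bsub>D\<^esub> (ar T ?r \<cdot>\<^bsub>D\<^esub> ?F)"
      by (simp only: l r)
    then have "(?e \<cdot>\<^bsub>D\<^esub> ar T ?l) \<cdot>\<^bsub>D\<^esub> ?F = (?e \<cdot>\<^bsub>D\<^esub> ar T ?r) \<cdot>\<^bsub>D\<^esub> ?F"
      using a x y by (simp add: adj_simps arrs)
    then have "?e \<cdot>\<^bsub>D\<^esub> ar T ?l = ?e \<cdot>\<^bsub>D\<^esub> ar T ?r"
      by (rule Q.D.iso_cancel_right[OF fmult_iso, rotated -1])
        (use a x y in \<open>simp_all add: Hom_def adj_simps arrs\<close>)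
    then show "?l = ?r"
      by (rule transpose_inject[rotated -1])
        (use a x y in \<open>simp_all add: Hom_def adj_simps arrs\<close>)
  next
    assume "?l = ?r"
    then have "?f \<cdot>\<^bsub>D\<^esub> ident D (ob T ?x) \<bullet>\<^bsub>D\<^esub> ?e = ?g \<cdot>\<^bsub>D\<^esub> ident D (ob T ?x) \<bullet>\<^bsub>D\<^esub> ?e"
      by (simp only: l[symmetric] r[symmetric])
    then show "?f = ?g"
      by (rule tens_counit_epi[OF assms(4,5) x a, rotated -1])
        (use a x y in \<open>simp_all add: Hom_def adj_simps arrs\<close>)
  qed
  \<comment> \<open>A quantum moment map is also required to be an algebra map;
    \<open>assms(7)\<close> supplies this.\<close>
  then show ?thesis
    using assms(7)
    by (simp add: quantum_moment_map_def is_central_def radj_algebra_def unit_algebra_def)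
qed

end
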